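(* Let $E\to M$ be a holomorphic vector bundle of finite rank on a complex manifold $M$, let $u\in C^1(M,Der^{(2)}(\Lambda E))$, and write $u=\sum_{k\ge1}u_{2k}$ with $u_{2k}\in C^1(M,Der_{2k}(\Lambda E))$. (1) If $du_2=0$, then $R_4(u)\in Z^2(M,End_4(\Lambda E))$. (2) If $du_2=0$ and $du_4=-R_4(u)$, then $R_6(u)\in Z^2(M,End_6(\Lambda E))$, and $$R_6(u)\in Z^2(M,Der_6(\Lambda E))\quad\Longleftrightarrow\quad R_6(u_2)\in C^2(M,Der_6(\Lambda E)).$$
   Context: $\mathcal O_{\Lambda E}$ is the sheaf of holomorphic sections of the exterior algebra bundle $\Lambda E$. $Der(\Lambda E)$ and $End(\Lambda E)$ are the sheaves of even $\mathbb C$-linear derivations, resp. endomorphisms, of $\mathcal O_{\Lambda E}$; $Der_{2k}(\Lambda E)$, $End_{2k}(\Lambda E)$ are the parts sending $\mathcal O_{\Lambda^jE}$ to $\mathcal O_{\Lambda^{j+2k}E}$ for all $j\ge 0$. Put $Der^{(2)}(\Lambda E)=\bigoplus_{k\ge1}Der_{2k}(\Lambda E)$ and $End^{(2)}(\Lambda E)=\bigoplus_{k\geq 1}End_{2k}(\Lambda E)$. $pr_{2k}$ denotes the projection onto the degree-$2k$ component, and $pr_{(2k)}$ the projection onto the sum of the components of degrees $2,4,\dots,2k$ (applied to an automorphism of the form $Id+\text{(element of }End^{(2)})$, these projections ignore the summand $Id$). All cochains are Čech cochains on a fixed open cover of $M$. 1-cochains $u=(u_{ij})$ of derivations are alternating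 ($u_{ji}=-u_{ij}$). $d$ is the usual additive Čech coboundary: $(dw)_{ijk}=w_{jk}-w_{ik}+w_{ij}$ on 1-cochains (so $(du)_{ijk}=u_{ij}+u_{jk}+u_{ki}$ for alternating $u$) and $(dw)_{ijkl}=w_{jkl}-w_{ikl}+w_{ijl}-w_{ijk}$ on 2-cochains; 2-cochains are not required to be alternating, and $Z^2$ denotes the 2-cochains with $dw=0$. For $u\in C^1(M,Der^{(2)}(\Lambda E))$ put $(\mathbf d\exp(u))_{ijk}=\exp(u_{ij})\exp(u_{jk})\exp(u_{ki})$ (the exponential series are finite by nilpotency), and for $q\ge2$ $$R_{2q}(u)=pr_{2q}\big(\mathbf d\exp(pr_{(2q-2)}(u))\big)\in C^2(M,End_{2q}(\Lambda E)).$$ Thus $R_4(u)=pr_4(\mathbf d\exp(u_2))$, $R_6(u)=pr_6(\mathbf d\exp(u_2+u_4))$ and $R_6(u_2)=pr_6(\mathbf d\exp(u_2))$. *)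

theory Defs
  imports "HOL-Analysis.Analysis" "HOL-Library.Function_Algebras"
begin

text \<open>
  Sections, operators on sections and cochains are functions, added and subtracted pointwise
  (\<open>Function_Algebras\<close>).  All of them are taken extensional: they are \<open>0\<close> outside the set on
  which they are meant to be defined, so that equality of functions is the intended equality.
\<close>

section \<open>Complex manifolds and holomorphic vector bundles\<close>

text \<open>The space \<open>\<complex>\<^sup>n\<close> (\<open>n = 0\<close> allowed), with the topology inherited from \<open>nat \<Rightarrow> complex\<close>.\<close>

definition cspace :: "nat \<Rightarrow> (nat \<Rightarrow> complex) set"
  where "cspace n = {z. \<forall>i\<ge>n. z i = 0}"

text \<open>
  Complex differentiability at every point \<open>z\<close> of an open \<open>W \<subseteq> \<complex>\<^sup>n\<close>, in the norm-free form
  \<open>f(w) = f(z) + \<Sum>\<^sub>i q\<^sub>i(w) (w\<^sub>i - z\<^sub>i)\<close> with functions \<open>q\<^sub>i\<close> continuous at \<open>z\<close>.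
\<close>

definition holomorphic_Cn :: "nat \<Rightarrow> (nat \<Rightarrow> complex) set \<Rightarrow> ((nat \<Rightarrow> complex) \<Rightarrow> complex) \<Rightarrow> bool"
  where "holomorphic_Cn n W f \<longleftrightarrow>
    (\<forall>z\<in>W. \<exists>q :: nat \<Rightarrow> (nat \<Rightarrow> complex) \<Rightarrow> complex.
       (\<forall>i<n. continuous (at z within W) (q i)) \<and>
       (\<forall>w\<in>W. f w = f z + (\<Sum>i<n. q i w * (w i - z i))))"

type_synonym 'm chart = "'m set \<times> ('m \<Rightarrow> nat \<Rightarrow> complex)"
type_synonym 'e triv = "'e \<Rightarrow> nat \<Rightarrow> complex"

definition second_countable_space :: "'m topology \<Rightarrow> bool"
  where "second_countable_space X \<longleftrightarrow>
    (\<exists>\<B>. countable \<B> \<and> (\<forall>V\<in>\<B>. openin X V) \<and>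
         (\<forall>V x. openin X V \<and> x \<in> V \<longrightarrow> (\<exists>B\<in>\<B>. x \<in> B \<and> B \<subseteq> V)))"

definition complex_manifold :: "'m topology \<Rightarrow> nat \<Rightarrow> 'm chart set \<Rightarrow> bool"
  where "complex_manifold X n \<A> \<longleftrightarrow>
    Hausdorff_space X \<and> second_countable_space X \<and>
    (\<Union>(D, \<phi>)\<in>\<A>. D) = topspace X \<and>
    (\<forall>(D, \<phi>)\<in>\<A>. openin X D \<and> openin (top_of_set (cspace n)) (\<phi> ` D) \<and>
        homeomorphic_map (subtopology X D) (top_of_set (\<phi> ` D)) \<phi>) \<and>
    (\<forall>(D, \<phi>)\<in>\<A>. \<forall>(D', \<phi>')\<in>\<A>. \<forall>i<n.
        holomorphic_Cn n (\<phi> ` (D \<inter> D')) (\<lambda>z. \<phi>' (inv_into D \<phi> z) i))"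

text \<open>Holomorphic functions on an open subset \<open>W\<close> of a manifold.\<close>

definition holomorphic_fun :: "nat \<Rightarrow> 'm chart set \<Rightarrow> 'm set \<Rightarrow> ('m \<Rightarrow> complex) \<Rightarrow> bool"
  where "holomorphic_fun n \<A> W f \<longleftrightarrow>
    (\<forall>(D, \<phi>)\<in>\<A>. holomorphic_Cn n (\<phi> ` (D \<inter> W)) (\<lambda>z. f (inv_into D \<phi> z)))"

text \<open>
  The data of a bundle \<open>E \<rightarrow> M\<close>: the topological spaces \<open>M\<close> and \<open>E\<close>, an atlas of \<open>M\<close>, the
  projection, the fibrewise vector space operations, and a family of local trivialisations
  \<open>e \<mapsto> (p e, \<tau> e)\<close>, each given by its domain in \<open>M\<close> and its \<open>\<complex>\<^sup>r\<close>-component \<open>\<tau>\<close>.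
\<close>

record ('m, 'e) vbundle =
  base :: "'m topology"
  basedim :: nat
  atlas :: "'m chart set"
  total :: "'e topology"
  bproj :: "'e \<Rightarrow> 'm"
  vadd :: "'e \<Rightarrow> 'e \<Rightarrow> 'e"
  vscale :: "complex \<Rightarrow> 'e \<Rightarrow> 'e"
  brank :: nat
  trivs :: "('m set \<times> 'e triv) set"

definition fibre :: "('m, 'e) vbundle \<Rightarrow> 'm \<Rightarrow> 'e set"
  where "fibre B x = {e \<in> topspace (total B). bproj B e = x}"

text \<open>
  The matrix \<open>g\<close> with \<open>\<tau> e = g (\<sigma> e)\<close> for \<open>e\<close> in the fibre over \<open>x\<close>: its column \<open>j\<close> is the
  \<open>\<tau>\<close>-coordinate vector of the \<open>j\<close>-th element of the \<open>\<sigma>\<close>-frame.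
\<close>

definition transition ::
    "('m, 'e) vbundle \<Rightarrow> 'e triv \<Rightarrow> 'e triv \<Rightarrow> 'm \<Rightarrow> nat \<Rightarrow> nat \<Rightarrow> complex"
  where "transition B \<sigma> \<tau> x i j =
    \<tau> (inv_into (fibre B x) \<sigma> (\<lambda>l. if l = j then 1 else 0)) i"

text \<open>
  The vector space axioms for the fibres are not listed: they follow from the fibrewise linear
  bijections onto \<open>\<complex>\<^sup>r\<close>.  The complex structure of the total space is the one for which the
  trivialisations are biholomorphic; it exists because the transition matrices are holomorphic.
\<close>

definition holomorphic_vector_bundle :: "('m, 'e) vbundle \<Rightarrow> bool"
  where "holomorphic_vector_bundle B \<longleftrightarrow>
    complex_manifold (base B) (basedim B) (atlas B) \<and>
    bproj B ` topspace (total B) \<subseteq> topspace (base B) \<and>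
    (\<Union>(W, \<tau>)\<in>trivs B. W) = topspace (base B) \<and>
    (\<forall>(W, \<tau>)\<in>trivs B. openin (base B) W \<and>
        openin (total B) {e \<in> topspace (total B). bproj B e \<in> W} \<and>
        homeomorphic_map (subtopology (total B) {e. bproj B e \<in> W})
          (prod_topology (subtopology (base B) W) (top_of_set (cspace (brank B))))
          (\<lambda>e. (bproj B e, \<tau> e)) \<and>
        (\<forall>x\<in>W. \<forall>e\<in>fibre B x.
           (\<forall>e'\<in>fibre B x. vadd B e e' \<in> fibre B x \<and> \<tau> (vadd B e e') = \<tau> e + \<tau> e') \<and>
           (\<forall>c. vscale B c e \<in> fibre B x \<and> \<tau> (vscale B c e) = (\<lambda>i. c * \<tau> e i)))) \<and>
    (\<forall>(W, \<sigma>)\<in>trivs B. \<forall>(W', \<tau>)\<in>trivs B. \<forall>i<brank B. \<forall>j<brank B.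
        holomorphic_fun (basedim B) (atlas B) (W \<inter> W') (\<lambda>x. transition B \<sigma> \<tau> x i j))"

section \<open>The exterior algebra bundle and its sheaf of sections\<close>

text \<open>
  An element of \<open>\<Lambda>(\<complex>\<^sup>r)\<close> is its coefficient function \<open>a\<close> with respect to the basis
  \<open>e\<^sub>K = e\<^sub>k\<^sub>1 \<and> \<dots> \<and> e\<^sub>k\<^sub>m\<close>, \<open>K = {k\<^sub>1 < \<dots> < k\<^sub>m} \<subseteq> {0,\<dots>,r-1}\<close>.  The wedge product is determined
  by \<open>e\<^sub>I \<and> e\<^sub>J = (-1)\<^sup>N e\<^sub>I\<^sub>\<union>\<^sub>J\<close> for disjoint \<open>I\<close>, \<open>J\<close>, where \<open>N\<close> counts the pairs
  \<open>(i, j) \<in> I \<times> J\<close> with \<open>j < i\<close>, and by \<open>e\<^sub>I \<and> e\<^sub>J = 0\<close> otherwise.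
\<close>

type_synonym ext = "nat set \<Rightarrow> complex"

definition ext_algebra :: "nat \<Rightarrow> ext set"
  where "ext_algebra r = {a. \<forall>K. a K \<noteq> 0 \<longrightarrow> K \<subseteq> {..<r}}"

definition inversions :: "nat set \<Rightarrow> nat set \<Rightarrow> nat"
  where "inversions I J = card {(i, j). i \<in> I \<and> j \<in> J \<and> j < i}"

definition wedge :: "ext \<Rightarrow> ext \<Rightarrow> ext"
  where "wedge a b = (\<lambda>K. \<Sum>I\<in>Pow K. (-1) ^ inversions I (K - I) * a I * b (K - I))"

definition ext_one :: ext
  where "ext_one = (\<lambda>K. if K = {} then 1 else 0)"

definition column :: "nat \<Rightarrow> (nat \<Rightarrow> nat \<Rightarrow> complex) \<Rightarrow> nat \<Rightarrow> ext"
  where "column r g j = (\<lambda>K. \<Sum>i<r. if K = {i} then g i j else 0)"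

text \<open>
  The map \<open>\<Lambda>g\<close> induced by an \<open>r \<times> r\<close>-matrix \<open>g\<close>: it is linear and sends \<open>e\<^sub>K\<close> to
  \<open>g e\<^sub>k\<^sub>1 \<and> \<dots> \<and> g e\<^sub>k\<^sub>m\<close>.
\<close>

definition ext_map :: "nat \<Rightarrow> (nat \<Rightarrow> nat \<Rightarrow> complex) \<Rightarrow> ext \<Rightarrow> ext"
  where "ext_map r g a = (\<lambda>L. \<Sum>K\<in>Pow {..<r}.
    a K * foldr wedge (map (column r g) (sorted_list_of_set K)) ext_one L)"

text \<open>
  \<open>\<Lambda>E\<close> is the bundle with fibre \<open>\<Lambda>(\<complex>\<^sup>r)\<close> and transition maps \<open>\<Lambda>g\<close>.  An element of its fibre over
  \<open>x\<close> is given by its coordinates with respect to all trivialisations of \<open>E\<close> around \<open>x\<close>.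
\<close>

type_synonym ('m, 'e) ext_elem = "'m set \<times> 'e triv \<Rightarrow> ext"

definition ext_fibre :: "('m, 'e) vbundle \<Rightarrow> 'm \<Rightarrow> ('m, 'e) ext_elem set"
  where "ext_fibre B x = {\<omega>.
    (\<forall>t. \<not> (t \<in> trivs B \<and> x \<in> fst t) \<longrightarrow> \<omega> t = 0) \<and>
    (\<forall>t\<in>trivs B. x \<in> fst t \<longrightarrow> \<omega> t \<in> ext_algebra (brank B)) \<and>
    (\<forall>s\<in>trivs B. \<forall>t\<in>trivs B. x \<in> fst s \<and> x \<in> fst t \<longrightarrow>
       \<omega> t = ext_map (brank B) (transition B (snd s) (snd t) x) (\<omega> s))}"

type_synonym ('m, 'e) sec = "'m \<Rightarrow> ('m, 'e) ext_elem"

definition hol_sec :: "('m, 'e) vbundle \<Rightarrow> 'm set \<Rightarrow> ('m, 'e) sec set"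
  where "hol_sec B V = {s.
    (\<forall>x. x \<notin> V \<longrightarrow> s x = 0) \<and> (\<forall>x\<in>V. s x \<in> ext_fibre B x) \<and>
    (\<forall>t\<in>trivs B. \<forall>K. holomorphic_fun (basedim B) (atlas B) (V \<inter> fst t) (\<lambda>x. s x t K))}"

definition sec_restrict :: "'m set \<Rightarrow> ('m, 'e) sec \<Rightarrow> ('m, 'e) sec"
  where "sec_restrict V s = (\<lambda>x. if x \<in> V then s x else 0)"

definition sec_scale :: "complex \<Rightarrow> ('m, 'e) sec \<Rightarrow> ('m, 'e) sec"
  where "sec_scale c s = (\<lambda>x t K. c * s x t K)"

definition sec_wedge :: "('m, 'e) sec \<Rightarrow> ('m, 'e) sec \<Rightarrow> ('m, 'e) sec"
  where "sec_wedge s s' = (\<lambda>x t. wedge (s x t) (s' x t))"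

text \<open>Sections whose components lie in the degrees satisfying \<open>P\<close>.\<close>

definition hol_sec_deg :: "('m, 'e) vbundle \<Rightarrow> (nat \<Rightarrow> bool) \<Rightarrow> 'm set \<Rightarrow> ('m, 'e) sec set"
  where "hol_sec_deg B P V = {s \<in> hol_sec B V. \<forall>x t K. s x t K \<noteq> 0 \<longrightarrow> P (card K)}"

definition sec_component :: "nat \<Rightarrow> ('m, 'e) sec \<Rightarrow> ('m, 'e) sec"
  where "sec_component j s = (\<lambda>x t K. if card K = j then s x t K else 0)"

section \<open>Sheaves of endomorphisms and derivations\<close>

text \<open>
  A section of a sheaf of operators over an open \<open>U\<close> is a morphism of sheaves over \<open>U\<close>, that is,
  a family of maps on sections over all open \<open>V \<subseteq> U\<close> compatible with restrictions.
\<close>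

type_synonym ('m, 'e) oper = "'m set \<Rightarrow> ('m, 'e) sec \<Rightarrow> ('m, 'e) sec"

definition oper_restrict ::
    "('m, 'e) vbundle \<Rightarrow> 'm set \<Rightarrow> ('m, 'e) oper \<Rightarrow> ('m, 'e) oper"
  where "oper_restrict B U f =
    (\<lambda>V s. if openin (base B) V \<and> V \<subseteq> U \<and> s \<in> hol_sec B V then f V s else 0)"

definition End :: "('m, 'e) vbundle \<Rightarrow> 'm set \<Rightarrow> ('m, 'e) oper set"
  where "End B U = {f.
    oper_restrict B U f = f \<and>
    (\<forall>V. openin (base B) V \<and> V \<subseteq> U \<longrightarrow>
       f V ` hol_sec B V \<subseteq> hol_sec B V \<and>
       (\<forall>s\<in>hol_sec B V. \<forall>s'\<in>hol_sec B V. f V (s + s') = f V s + f V s') \<and>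
       (\<forall>c. \<forall>s\<in>hol_sec B V. f V (sec_scale c s) = sec_scale c (f V s)) \<and>
       f V ` hol_sec_deg B even V \<subseteq> hol_sec_deg B even V \<and>
       f V ` hol_sec_deg B odd V \<subseteq> hol_sec_deg B odd V \<and>
       (\<forall>V'. openin (base B) V' \<and> V' \<subseteq> V \<longrightarrow>
          (\<forall>s\<in>hol_sec B V. f V' (sec_restrict V' s) = sec_restrict V' (f V s))))}"

definition Der :: "('m, 'e) vbundle \<Rightarrow> 'm set \<Rightarrow> ('m, 'e) oper set"
  where "Der B U = {f \<in> End B U. \<forall>V. openin (base B) V \<and> V \<subseteq> U \<longrightarrow>
    (\<forall>s\<in>hol_sec B V. \<forall>s'\<in>hol_sec B V.
       f V (sec_wedge s s') = sec_wedge (f V s) s' + sec_wedge s (f V s'))}"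

text \<open>The argument \<open>d\<close> in \<open>End_deg\<close>, \<open>Der_deg\<close> and \<open>pr\<close> is the degree itself, not half of it.\<close>

definition End_deg :: "('m, 'e) vbundle \<Rightarrow> nat \<Rightarrow> 'm set \<Rightarrow> ('m, 'e) oper set"
  where "End_deg B d U = {f \<in> End B U. \<forall>V j. openin (base B) V \<and> V \<subseteq> U \<longrightarrow>
    f V ` hol_sec_deg B (\<lambda>m. m = j) V \<subseteq> hol_sec_deg B (\<lambda>m. m = j + d) V}"

definition Der_deg :: "('m, 'e) vbundle \<Rightarrow> nat \<Rightarrow> 'm set \<Rightarrow> ('m, 'e) oper set"
  where "Der_deg B d U = Der B U \<inter> End_deg B d U"

text \<open>The sheaf \<open>Der\<^sup>(\<^sup>2\<^sup>)\<close>, the direct sum of the \<open>Der\<^sub>2\<^sub>k\<close> with \<open>k \<ge> 1\<close>.\<close>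

definition Der_pos :: "('m, 'e) vbundle \<Rightarrow> 'm set \<Rightarrow> ('m, 'e) oper set"
  where "Der_pos B U = {f. \<exists>N g. (\<forall>k\<in>{1..N}. g k \<in> Der_deg B (2 * k) U) \<and> f = (\<Sum>k=1..N. g k)}"

text \<open>
  The degree-\<open>d\<close> component of an operator \<open>f\<close>, which sends \<open>s\<close> of degree \<open>j\<close> to the component of
  \<open>f s\<close> in degree \<open>j + d\<close>.  For \<open>d > 0\<close> it annihilates the identity.
\<close>

definition pr :: "('m, 'e) vbundle \<Rightarrow> nat \<Rightarrow> ('m, 'e) oper \<Rightarrow> ('m, 'e) oper"
  where "pr B d f = (\<lambda>V s. if s \<in> hol_sec B V
    then \<Sum>j\<le>brank B. sec_component (j + d) (f V (sec_component j s)) else 0)"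

definition oper_exp :: "('m, 'e) oper \<Rightarrow> ('m, 'e) oper"
  where "oper_exp f = (\<lambda>V s x t K. \<Sum>m. (f V ^^ m) s x t K / fact m)"

definition oper_comp :: "('m, 'e) oper \<Rightarrow> ('m, 'e) oper \<Rightarrow> ('m, 'e) oper"
  where "oper_comp f g = (\<lambda>V s. f V (g V s))"

section \<open>Cech cochains\<close>

definition open_cover :: "'m topology \<Rightarrow> 'i set \<Rightarrow> ('i \<Rightarrow> 'm set) \<Rightarrow> bool"
  where "open_cover X I U \<longleftrightarrow> (\<forall>i\<in>I. openin X (U i)) \<and> (\<Union>i\<in>I. U i) = topspace X"

type_synonym ('i, 'm, 'e) cochain1 = "'i \<Rightarrow> 'i \<Rightarrow> ('m, 'e) oper"
type_synonym ('i, 'm, 'e) cochain2 = "'i \<Rightarrow> 'i \<Rightarrow> 'i \<Rightarrow> ('m, 'e) oper"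
type_synonym ('i, 'm, 'e) cochain3 = "'i \<Rightarrow> 'i \<Rightarrow> 'i \<Rightarrow> 'i \<Rightarrow> ('m, 'e) oper"

text \<open>1-cochains are alternating, 2-cochains need not be.\<close>

definition C1 :: "'i set \<Rightarrow> ('i \<Rightarrow> 'm set) \<Rightarrow> ('m set \<Rightarrow> ('m, 'e) oper set) \<Rightarrow>
    ('i, 'm, 'e) cochain1 set"
  where "C1 I U F = {u.
    (\<forall>i\<in>I. \<forall>j\<in>I. u i j \<in> F (U i \<inter> U j) \<and> u j i = - u i j) \<and>
    (\<forall>i j. \<not> (i \<in> I \<and> j \<in> I) \<longrightarrow> u i j = 0)}"

definition C2 :: "'i set \<Rightarrow> ('i \<Rightarrow> 'm set) \<Rightarrow> ('m set \<Rightarrow> ('m, 'e) oper set) \<Rightarrow>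
    ('i, 'm, 'e) cochain2 set"
  where "C2 I U F = {w.
    (\<forall>i\<in>I. \<forall>j\<in>I. \<forall>k\<in>I. w i j k \<in> F (U i \<inter> U j \<inter> U k)) \<and>
    (\<forall>i j k. \<not> (i \<in> I \<and> j \<in> I \<and> k \<in> I) \<longrightarrow> w i j k = 0)}"

definition coboundary1 :: "('m, 'e) vbundle \<Rightarrow> 'i set \<Rightarrow> ('i \<Rightarrow> 'm set) \<Rightarrow>
    ('i, 'm, 'e) cochain1 \<Rightarrow> ('i, 'm, 'e) cochain2"
  where "coboundary1 B I U w = (\<lambda>i j k. if i \<in> I \<and> j \<in> I \<and> k \<in> I
    then oper_restrict B (U i \<inter> U j \<inter> U k) (w j k - w i k + w i j) else 0)"

definition coboundary2 :: "('m, 'e) vbundle \<Rightarrow> 'i set \<Rightarrow> ('i \<Rightarrow> 'm set) \<Rightarrow>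
    ('i, 'm, 'e) cochain2 \<Rightarrow> ('i, 'm, 'e) cochain3"
  where "coboundary2 B I U w = (\<lambda>i j k l. if i \<in> I \<and> j \<in> I \<and> k \<in> I \<and> l \<in> I
    then oper_restrict B (U i \<inter> U j \<inter> U k \<inter> U l) (w j k l - w i k l + w i j l - w i j k) else 0)"

definition Z2 :: "('m, 'e) vbundle \<Rightarrow> 'i set \<Rightarrow> ('i \<Rightarrow> 'm set) \<Rightarrow>
    ('m set \<Rightarrow> ('m, 'e) oper set) \<Rightarrow> ('i, 'm, 'e) cochain2 set"
  where "Z2 B I U F = {w \<in> C2 I U F. coboundary2 B I U w = 0}"

definition dexp :: "('m, 'e) vbundle \<Rightarrow> 'i set \<Rightarrow> ('i \<Rightarrow> 'm set) \<Rightarrow>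
    ('i, 'm, 'e) cochain1 \<Rightarrow> ('i, 'm, 'e) cochain2"
  where "dexp B I U u = (\<lambda>i j k. if i \<in> I \<and> j \<in> I \<and> k \<in> I
    then oper_restrict B (U i \<inter> U j \<inter> U k)
      (oper_comp (oper_exp (u i j)) (oper_comp (oper_exp (u j k)) (oper_exp (u k i)))) else 0)"

definition pr1 :: "('m, 'e) vbundle \<Rightarrow> nat \<Rightarrow> ('i, 'm, 'e) cochain1 \<Rightarrow> ('i, 'm, 'e) cochain1"
  where "pr1 B d u = (\<lambda>i j. pr B d (u i j))"

definition pr2 :: "('m, 'e) vbundle \<Rightarrow> nat \<Rightarrow> ('i, 'm, 'e) cochain2 \<Rightarrow> ('i, 'm, 'e) cochain2"
  where "pr2 B d w = (\<lambda>i j k. pr B d (w i j k))"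

text \<open>Here \<open>R B I U d\<close> is \<open>R\<^sub>d\<close> for even \<open>d = 2q \<ge> 4\<close>; the sum is \<open>pr\<^sub>(\<^sub>2\<^sub>q\<^sub>-\<^sub>2\<^sub>)(u)\<close>.\<close>

definition R :: "('m, 'e) vbundle \<Rightarrow> 'i set \<Rightarrow> ('i \<Rightarrow> 'm set) \<Rightarrow> nat \<Rightarrow>
    ('i, 'm, 'e) cochain1 \<Rightarrow> ('i, 'm, 'e) cochain2"
  where "R B I U d u = pr2 B d (dexp B I U (\<Sum>k = 1..d div 2 - 1. pr1 B (2 * k) u))"

end

theory Submission
  imports Defs
begin

text \<open>
  Put \<open>a = u\<^sub>i\<^sub>j\<close> and \<open>b = u\<^sub>j\<^sub>k\<close>.  The hypotheses express the components of \<open>u\<^sub>k\<^sub>i\<close> through those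
  of \<open>a\<close> and \<open>b\<close>, and the homogeneous parts of \<open>exp(u\<^sub>i\<^sub>j) exp(u\<^sub>j\<^sub>k) exp(u\<^sub>k\<^sub>i)\<close> become the Lie
  polynomials of the Baker-Campbell-Hausdorff formula:
  \<open>R\<^sub>4(u) = 1/2 [a\<^sub>2, b\<^sub>2]\<close>,
  \<open>R\<^sub>6(u) = 1/2 ([a\<^sub>2, b\<^sub>4] + [a\<^sub>4, b\<^sub>2]) + 1/12 ([a\<^sub>2, [a\<^sub>2, b\<^sub>2]] - [b\<^sub>2, [a\<^sub>2, b\<^sub>2]])\<close> and
  \<open>R\<^sub>6(u\<^sub>2) = 1/3 [a\<^sub>2, [a\<^sub>2, b\<^sub>2]] + 1/6 [b\<^sub>2, [a\<^sub>2, b\<^sub>2]]\<close>.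
  Hence all three are cochains of derivations, so that both sides of the equivalence hold, and the
  cocycle conditions are identities in the free associative algebra.  The bracket of two derivations
  is a derivation because wedge products of sections are sections, that is, because the maps
  \<open>\<Lambda>g\<close> are multiplicative.
\<close>

section \<open>The exterior algebra\<close>

text \<open>Why Lie polynomials must appear: the logarithm of a product of exponentials of
  derivations is a Lie series. Under the hypotheses the triple product for u_2 + u_4 is the identity
  plus terms of degree at least 6, and the one for u_2 alone is the identity plus terms of degree at
  least 4, whose products start in degree 8. In both cases the degree-6 part of the product is
  therefore the degree-6 part of its logarithm. Write Z = log(exp(a) exp(b)). The hypotheses on du_2
  and du_4 say that the components of u_ki are -Z_2 and -Z_4, so that R_6(u) is Z_6 itself, and the
  cocycle conditions express associativity of the Baker-Campbell-Hausdorff product. No logarithm is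
  formed in the proof: exponentials are expanded up to degree 6, where a product of four operators
  already has degree at least 8, and words are compared. The obstacle is that an operator is
  additive only on holomorphic sections over a fixed open set, so this algebra cannot take place in
  a ring of functions and is carried out relative to \<open>hol_sec B V\<close>.\<close>

lemma finite_inversions: "finite I \<Longrightarrow> finite J \<Longrightarrow> finite {(i, j). i \<in> I \<and> j \<in> J \<and> j < i}"
  by (rule finite_subset[of _ "I \<times> J"]) auto

text \<open>With its mirror image below, this makes the sign \<open>(-1) ^ inversions I J\<close>
  multiplicative in each argument over disjoint unions, the source of associativity and of the signs
  in \<open>column_wedge_mult\<close>.\<close>

lemma inversions_Un_left:
  assumes "finite I" "finite I'" "finite J" "I \<inter> I' = {}"
  shows "inversions (I \<union> I') J = inversions I J + inversions I' J"
proof -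
  have "{(i, j). i \<in> I \<union> I' \<and> j \<in> J \<and> j < i} =
      {(i, j). i \<in> I \<and> j \<in> J \<and> j < i} \<union> {(i, j). i \<in> I' \<and> j \<in> J \<and> j < i}" by auto
  then show ?thesis
    unfolding inversions_def using assms by (auto intro!: card_Un_disjoint finite_inversions)
qed

lemma inversions_Un_right:
  assumes "finite I" "finite J" "finite J'" "J \<inter> J' = {}"
  shows "inversions I (J \<union> J') = inversions I J + inversions I J'"
proof -
  have "{(i, j). i \<in> I \<and> j \<in> J \<union> J' \<and> j < i} =
      {(i, j). i \<in> I \<and> j \<in> J \<and> j < i} \<union> {(i, j). i \<in> I \<and> j \<in> J' \<and> j < i}" by auto
  then show ?thesis
    unfolding inversions_def using assms by (auto intro!: card_Un_disjoint finite_inversions)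
qed

lemma inversions_empty [simp]: "inversions {} J = 0" "inversions I {} = 0"
  by (simp_all add: inversions_def)

lemma inversions_singletons: "inversions {i} {j} = (if j < i then 1 else 0)"
proof -
  have "{(i', j'). i' \<in> {i} \<and> j' \<in> {j} \<and> j' < i'} = (if j < i then {(i, j)} else {})" by auto
  then show ?thesis by (simp add: inversions_def)
qed

text \<open>\<open>Pow K\<close> is then infinite, and a sum over an infinite set is 0 by
  convention. Identities about \<open>wedge\<close> thus have content only at finite
  \<open>K\<close>.\<close>

lemma wedge_infinite: "infinite K \<Longrightarrow> wedge a b K = 0"
  by (simp add: wedge_def finite_Pow_iff)

lemma wedge_add_left: "wedge (a + a') b = wedge a b + wedge a' b"
  by (simp add: wedge_def fun_eq_iff ring_distribs sum.distrib)

lemma wedge_add_right: "wedge a (b + b') = wedge a b + wedge a b'"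
  by (simp add: wedge_def fun_eq_iff ring_distribs sum.distrib)

lemma wedge_scale_left: "wedge (\<lambda>K. c * a K) b = (\<lambda>K. c * wedge a b K)"
  by (simp add: wedge_def fun_eq_iff sum_distrib_left mult_ac)

lemma wedge_scale_right: "wedge a (\<lambda>K. c * b K) = (\<lambda>K. c * wedge a b K)"
  by (simp add: wedge_def fun_eq_iff sum_distrib_left mult_ac)

lemma wedge_zero [simp]: "wedge 0 b = 0" "wedge a 0 = 0"
  by (simp_all add: wedge_def fun_eq_iff)

lemma sum_apply: "(\<Sum>i\<in>A. f i) x = (\<Sum>i\<in>A. f i x)"
  by (induction A rule: infinite_finite_induct) auto

lemma wedge_sum_left: "wedge (\<Sum>i\<in>A. f i) b = (\<Sum>i\<in>A. wedge (f i) b)"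
  using sum_comp_morphism[of "\<lambda>a. wedge a b" f A, OF wedge_zero(1) wedge_add_left] by (simp add: o_def)

lemma wedge_sum_right: "wedge a (\<Sum>i\<in>A. f i) = (\<Sum>i\<in>A. wedge a (f i))"
  using sum_comp_morphism[of "wedge a" f A, OF wedge_zero(2) wedge_add_right] by (simp add: o_def)

text \<open>Both sides sum over the ordered partitions of \<open>K\<close> into three blocks, and by
  additivity of \<open>inversions\<close> both signs count the inversions between all three pairs of
  blocks.\<close>

lemma wedge_assoc: "wedge (wedge a b) c = wedge a (wedge b c)"
proof
  fix K :: "nat set"
  show "wedge (wedge a b) c K = wedge a (wedge b c) K"
  proof (cases "finite K")
    case True
    let ?l = "\<lambda>L I. (-1) ^ inversions L (K - L) * (-1) ^ inversions I (L - I) * a I * b (L - I) * c (K - L)"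
    let ?r = "\<lambda>I J. (-1) ^ inversions I (K - I) * (-1) ^ inversions J (K - I - J) * a I * b J * c (K - I - J)"
    have "wedge (wedge a b) c K = (\<Sum>L\<in>Pow K. \<Sum>I\<in>Pow L. ?l L I)"
      by (simp add: wedge_def sum_distrib_left sum_distrib_right mult_ac)
    also have "\<dots> = (\<Sum>(L, I)\<in>Sigma (Pow K) Pow. ?l L I)"
      by (rule sum.Sigma) (use True in \<open>auto intro: finite_subset\<close>)
    \<comment> \<open>A chain \<open>I \<subseteq> L \<subseteq> K\<close> corresponds to the
      partition with blocks \<open>I\<close>, \<open>J = L - I\<close> and
      \<open>K - L\<close>.\<close>
    also have "\<dots> = (\<Sum>(I, J)\<in>Sigma (Pow K) (\<lambda>I. Pow (K - I)). ?r I J)"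
    proof (rule sum.reindex_bij_witness[where j = "\<lambda>(L, I). (I, L - I)" and i = "\<lambda>(I, J). (I \<union> J, I)"], goal_cases)
      case (5 p)
      obtain L I where p: "p = (L, I)" "L \<subseteq> K" "I \<subseteq> L" using 5 by auto
      have fin: "finite L" "finite I" "finite (L - I)" "finite (K - L)"
        using p True by (auto intro: finite_subset)
      have 1: "inversions L (K - L) = inversions I (K - L) + inversions (L - I) (K - L)"
        using inversions_Un_left[of I "L - I" "K - L"] fin p by (simp add: Un_absorb1)
      have e: "K - I = (L - I) \<union> (K - L)" "K - I - (L - I) = K - L" using p by auto
      have 2: "inversions I (K - I) = inversions I (L - I) + inversions I (K - L)"
        unfolding e(1) by (rule inversions_Un_right) (use fin in auto)
      show ?case by (simp add: p 1 2 e(2) power_add)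
    qed auto
    also have "\<dots> = (\<Sum>I\<in>Pow K. \<Sum>J\<in>Pow (K - I). ?r I J)"
      by (rule sum.Sigma[symmetric]) (use True in auto)
    also have "\<dots> = wedge a (wedge b c) K"
      by (simp add: wedge_def sum_distrib_left mult_ac)
    finally show ?thesis .
  qed (simp add: wedge_infinite)
qed

lemma wedge_nonzeroE:
  assumes "wedge a b K \<noteq> 0"
  obtains I where "finite K" "I \<subseteq> K" "a I \<noteq> 0" "b (K - I) \<noteq> 0"
proof -
  have "finite K" using assms wedge_infinite by blast
  moreover obtain I where "I \<in> Pow K" "(-1) ^ inversions I (K - I) * a I * b (K - I) \<noteq> 0"
    using assms unfolding wedge_def by (meson sum.not_neutral_contains_not_neutral)
  ultimately show ?thesis using that by auto
qed

lemma wedge_ext_algebra: "a \<in> ext_algebra r \<Longrightarrow> b \<in> ext_algebra r \<Longrightarrow> wedge a b \<in> ext_algebra r"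
  unfolding ext_algebra_def by (fastforce elim!: wedge_nonzeroE)

text \<open>Membership in \<open>ext_algebra r\<close> takes care of infinite \<open>K\<close>,
  where \<open>wedge\<close> is 0 by convention and \<open>a K\<close> must be 0 as well.\<close>

lemma wedge_one_left:
  assumes "a \<in> ext_algebra r"
  shows "wedge ext_one a = a"
proof
  fix K
  show "wedge ext_one a K = a K"
  proof (cases "finite K")
    case True
    have "wedge ext_one a K = (\<Sum>I\<in>Pow K. if I = {} then a K else 0)"
      unfolding wedge_def by (rule sum.cong) (auto simp: ext_one_def)
    then show ?thesis using True by simp
  next
    case False
    then have "a K = 0" using assms finite_subset by (fastforce simp: ext_algebra_def)
    then show ?thesis using False by (simp add: wedge_infinite)
  qed
qed

section \<open>Degree-1 elements and induced maps on the exterior algebra\<close>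

definition ext_vectors :: "ext set"
  where "ext_vectors = {v. \<forall>K. v K \<noteq> 0 \<longrightarrow> (\<exists>i. K = {i})}"

text \<open>Complementation \<open>I \<mapsto> K - I\<close> exchanges the two factors. Only
  two-element \<open>K\<close> contribute, and of two distinct indices exactly one order is an
  inversion, so the sign flips.\<close>

lemma wedge_vectors_anticommute:
  assumes "v \<in> ext_vectors" "w \<in> ext_vectors"
  shows "wedge v w = - wedge w v"
proof
  fix K
  show "wedge v w K = (- wedge w v) K"
  proof (cases "finite K")
    case True
    have "wedge v w K = (\<Sum>I\<in>Pow K. (-1) ^ inversions (K - I) I * v (K - I) * w I)"
      unfolding wedge_def
      by (rule sum.reindex_bij_witness[where i = "\<lambda>I. K - I" and j = "\<lambda>I. K - I"])
         (auto simp: double_diff)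
    also have "\<dots> = (\<Sum>I\<in>Pow K. - ((-1) ^ inversions I (K - I) * w I * v (K - I)))"
    proof (rule sum.cong[OF refl])
      fix I assume I: "I \<in> Pow K"
      show "(-1) ^ inversions (K - I) I * v (K - I) * w I =
          - ((-1) ^ inversions I (K - I) * w I * v (K - I))"
      proof (cases "v (K - I) = 0 \<or> w I = 0")
        case False
        then have "\<exists>i. K - I = {i}" "\<exists>j. I = {j}"
          using assms by (simp_all add: ext_vectors_def)
        then obtain i j where ij: "K - I = {i}" "I = {j}" by auto
        then have "i \<noteq> j" by auto
        then show ?thesis
            unfolding ij(1) unfolding ij(2) by (auto simp: inversions_singletons)
      qed auto
    qed
    also have "\<dots> = (- wedge w v) K" by (simp add: wedge_def sum_negf)
    finally show ?thesis .
  qed (simp add: wedge_infinite)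
qed

lemma wedge_vector_square:
  assumes "v \<in> ext_vectors" shows "wedge v v = 0"
proof
  fix K show "wedge v v K = 0 K"
    using fun_cong[OF wedge_vectors_anticommute[OF assms assms], of K] by simp
qed

lemma column_vector: "column r g j \<in> ext_vectors"
proof -
  have "column r g j K = 0" if "\<nexists>i. K = {i}" for K
    using that unfolding column_def by (intro sum.neutral) auto
  then show ?thesis unfolding ext_vectors_def by auto
qed

lemma column_ext_algebra: "column r g j \<in> ext_algebra r"
proof -
  have "column r g j K = 0" if "\<not> K \<subseteq> {..<r}" for K
    using that unfolding column_def by (intro sum.neutral) auto
  then show ?thesis unfolding ext_algebra_def by blast
qed

text \<open>The image of the basis element \<open>e_K\<close> under the induced map, as it occurs
  inside \<open>ext_map\<close>; named so that induction on \<open>K\<close> becomes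
  possible.\<close>

definition column_wedge :: "nat \<Rightarrow> (nat \<Rightarrow> nat \<Rightarrow> complex) \<Rightarrow> nat set \<Rightarrow> ext"
  where "column_wedge r g K = foldr wedge (map (column r g) (sorted_list_of_set K)) ext_one"

lemma column_wedge_empty: "column_wedge r g {} = ext_one"
  by (simp add: column_wedge_def)

lemma column_wedge_insert_min:
  assumes "finite K" "\<And>k. k \<in> K \<Longrightarrow> i < k"
  shows "column_wedge r g (insert i K) = wedge (column r g i) (column_wedge r g K)"
proof -
  have "i \<notin> K" using assms(2) by blast
  moreover have "insort i (sorted_list_of_set K) = i # sorted_list_of_set K"
    by (rule insort_is_Cons) (use assms in \<open>auto simp: less_imp_le\<close>)
  ultimately have "sorted_list_of_set (insert i K) = i # sorted_list_of_set K"
    using assms(1) by (simp add: sorted_list_of_set_insert)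
  then show ?thesis by (simp add: column_wedge_def)
qed

text \<open>Inserting a new minimum prepends to the sorted list of indices. It therefore matches the
  \<open>foldr\<close> in \<open>column_wedge\<close> and produces no sign.\<close>

lemma finite_nat_min_induct [consumes 1, case_names empty insert]:
  fixes K :: "nat set"
  assumes "finite K" "P {}"
    and "\<And>i K. finite K \<Longrightarrow> (\<And>k. k \<in> K \<Longrightarrow> i < k) \<Longrightarrow> P K \<Longrightarrow> P (insert i K)"
  shows "P K"
  using assms(1)
proof (induction "card K" arbitrary: K)
  case 0 then show ?case using assms(2) by simp
next
  case (Suc n)
  then have ne: "K \<noteq> {}" by auto
  let ?K = "K - {Min K}"
  have "P (insert (Min K) ?K)"
  proof (rule assms(3))
    show "P ?K" by (rule Suc.hyps(1)) (use Suc.hyps(2) Suc.prems ne in auto)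
    show "Min K < k" if "k \<in> ?K" for k
      using that Min_le[OF Suc.prems, of k] by (auto simp: le_less)
  qed (use Suc.prems in auto)
  moreover have "insert (Min K) ?K = K" using ne Suc.prems by (simp add: insert_absorb)
  ultimately show ?case by simp
qed

lemma column_wedge_ext_algebra: "finite K \<Longrightarrow> column_wedge r g K \<in> ext_algebra r"
  by (induction K rule: finite_nat_min_induct)
     (auto simp: column_wedge_empty column_wedge_insert_min ext_one_def
       intro: wedge_ext_algebra column_ext_algebra, auto simp: ext_algebra_def)

lemma column_wedge_degree:
  "finite K \<Longrightarrow> column_wedge r g K L \<noteq> 0 \<Longrightarrow> card L = card K"
proof (induction K arbitrary: L rule: finite_nat_min_induct)
  case empty
  then show ?case by (auto simp: column_wedge_empty ext_one_def split: if_splits)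
next
  case (insert i K)
  have "i \<notin> K" using insert.hyps(2) by blast
  obtain J where J: "finite L" "J \<subseteq> L" "column r g i J \<noteq> 0" "column_wedge r g K (L - J) \<noteq> 0"
    using insert.prems insert.hyps by (auto simp: column_wedge_insert_min elim: wedge_nonzeroE)
  have "\<exists>j. J = {j}" using J(3) column_vector[of r g i] by (simp add: ext_vectors_def)
  then obtain j where "J = {j}" ..
  then show ?case using insert.IH[OF J(4)] J(1,2) insert.hyps(1) \<open>i \<notin> K\<close>
    by (metis card_Suc_Diff1 card_insert_disjoint insert_subset)
qed

text \<open>The column \<open>i\<close> travels to its sorted place past the columns of smaller
  index, each transposition costing one sign; if it meets itself on the way, the square of a vector
  gives 0.\<close>

lemma column_wedge_column:
  assumes "finite J"
  shows "wedge (column r g i) (column_wedge r g J) =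
    (if i \<in> J then 0 else (\<lambda>L. (-1) ^ inversions {i} J * column_wedge r g (insert i J) L))"
  using assms
proof (induction J rule: finite_nat_min_induct)
  case empty
  then show ?case using column_wedge_insert_min[of "{}" i r g] by simp
next
  case (insert j J)
  note G = column_wedge_insert_min[OF insert.hyps]
  have jJ: "j \<notin> J" using insert.hyps(2) by blast
  have inv: "inversions {i} (insert j J) = inversions {i} {j} + inversions {i} J"
    using inversions_Un_right[of "{i}" "{j}" J] insert.hyps jJ by simp
  consider "i < j" | "i = j" | "j < i" by linarith
  then show ?case
  proof cases
    case 1
    then have gt: "\<And>k. k \<in> insert j J \<Longrightarrow> i < k" using insert.hyps(2) by force
    have 2: "inversions {i} (insert j J) = 0"
      using gt by (auto simp: inversions_def card_eq_0_iff dest: less_asym)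
    have "i \<notin> insert j J" using gt by blast
    moreover have "column_wedge r g (insert i (insert j J)) =
        wedge (column r g i) (column_wedge r g (insert j J))"
      by (rule column_wedge_insert_min) (use gt insert.hyps(1) in auto)
    ultimately show ?thesis by (simp add: 2)
  next
    case 2
    have "wedge (column r g i) (wedge (column r g i) (column_wedge r g J)) = 0"
      unfolding wedge_assoc[symmetric] by (simp add: wedge_vector_square column_vector)
    then show ?thesis using 2 by (simp add: G)
  next
    case 3
    have neg: "wedge (- a) b = - wedge a b" for a b
      using wedge_scale_left[of "-1" a b] by (simp add: fun_Compl_def)
    have "wedge (column r g i) (column_wedge r g (insert j J)) =
        wedge (wedge (column r g i) (column r g j)) (column_wedge r g J)"
      by (simp add: G wedge_assoc)
    also have "\<dots> = - wedge (column r g j) (wedge (column r g i) (column_wedge r g J))"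
      by (subst wedge_vectors_anticommute) (simp_all add: column_vector neg wedge_assoc)
    also have "\<dots> = (if i \<in> insert j J then 0
        else (\<lambda>L. (-1) ^ inversions {i} (insert j J) * column_wedge r g (insert i (insert j J)) L))"
    proof (cases "i \<in> J")
      case True
      then have "wedge (column r g i) (column_wedge r g J) = 0" by (simp only: insert.IH if_True if_False)
      moreover have "i \<in> insert j J" using True by simp
      ultimately show ?thesis by (simp only: wedge_zero if_True minus_zero)
    next
      case False
      have "column_wedge r g (insert j (insert i J)) =
          wedge (column r g j) (column_wedge r g (insert i J))"
        by (rule column_wedge_insert_min) (use insert.hyps 3 in auto)
      then show ?thesis using False 3
        by (simp add: insert.IH wedge_scale_right inv inversions_singletons insert_commute fun_eq_iff)
    qed
    finally show ?thesis .
  qed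
qed

text \<open>The images of the basis elements obey the same multiplication table as the basis itself.
  The columns of \<open>I\<close> are moved into \<open>J\<close> one at a time, starting with the
  largest.\<close>

lemma column_wedge_mult:
  assumes "finite I" "finite J"
  shows "wedge (column_wedge r g I) (column_wedge r g J) =
    (if I \<inter> J = {} then (\<lambda>L. (-1) ^ inversions I J * column_wedge r g (I \<union> J) L) else 0)"
  using assms(1)
proof (induction I rule: finite_nat_min_induct)
  case empty
  then show ?case
    using wedge_one_left[OF column_wedge_ext_algebra[OF assms(2)]] by (simp add: column_wedge_empty)
next
  case (insert i I)
  have iI: "i \<notin> I" using insert.hyps(2) by blast
  have eq: "wedge (column_wedge r g (insert i I)) (column_wedge r g J) =
      wedge (column r g i) (wedge (column_wedge r g I) (column_wedge r g J))"
    by (simp add: column_wedge_insert_min[OF insert.hyps] wedge_assoc)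
  show ?case
  proof (cases "I \<inter> J = {}")
    case False
    then have "wedge (column_wedge r g I) (column_wedge r g J) = 0" by (simp only: insert.IH if_True if_False)
    moreover have "\<not> insert i I \<inter> J = {}" using False by blast
    ultimately show ?thesis by (simp only: eq wedge_zero if_False)
  next
    case True
    have "inversions {i} I = 0"
      using insert.hyps(2) by (auto simp: inversions_def card_eq_0_iff dest: less_asym)
    then have 1: "inversions {i} (I \<union> J) = inversions {i} J"
      using inversions_Un_right[of "{i}" I J] insert.hyps assms(2) True by simp
    have 2: "inversions (insert i I) J = inversions {i} J + inversions I J"
      using inversions_Un_left[of "{i}" I J] insert.hyps assms(2) iI by simp
    show ?thesis
      using True iI insert.hyps(1) assms(2)
      by (simp add: eq insert.IH wedge_scale_right column_wedge_column 1 2 power_add fun_eq_iff mult_ac)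
  qed
qed

lemma ext_map_eq: "ext_map r g a = (\<Sum>K\<in>Pow {..<r}. (\<lambda>L. a K * column_wedge r g K L))"
  by (simp add: ext_map_def column_wedge_def fun_eq_iff sum_apply)

lemma ext_map_add: "ext_map r g (a + b) = ext_map r g a + ext_map r g b"
  by (simp add: ext_map_def fun_eq_iff ring_distribs sum.distrib)

lemma ext_map_scale: "ext_map r g (\<lambda>K. c * a K) = (\<lambda>L. c * ext_map r g a L)"
  by (simp add: ext_map_def fun_eq_iff sum_distrib_left mult_ac)

text \<open>Induced maps preserve degree, so the grading of a section does not depend on the
  trivialisation.\<close>

lemma ext_map_component:
  "ext_map r g (\<lambda>K. if card K = j then a K else 0) =
    (\<lambda>L. if card L = j then ext_map r g a L else 0)"
proof
  fix L
  have "(if card K = j then a K else 0) * column_wedge r g K L =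
      (if card L = j then a K * column_wedge r g K L else 0)" if "K \<in> Pow {..<r}" for K
    using column_wedge_degree[of K r g L] finite_subset[of K "{..<r}"] that
    by (cases "column_wedge r g K L = 0") auto
  from sum.cong[OF refl this, of "Pow {..<r}"]
  show "ext_map r g (\<lambda>K. if card K = j then a K else 0) L =
      (if card L = j then ext_map r g a L else 0)"
    unfolding ext_map_def column_wedge_def[symmetric]
    by simp
qed

text \<open>Pairs \<open>(I, J)\<close> that meet drop out by \<open>column_wedge_mult\<close>. A
  disjoint pair is the same as a set \<open>K = I \<union> J\<close> with a subset \<open>I\<close>,
  which is the way \<open>wedge\<close> sums.\<close>

lemma ext_map_wedge:
  assumes "a \<in> ext_algebra r" "b \<in> ext_algebra r"
  shows "ext_map r g (wedge a b) = wedge (ext_map r g a) (ext_map r g b)"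
proof
  fix L
  let ?G = "column_wedge r g" and ?S = "Pow {..<r} :: nat set set"
  let ?f = "\<lambda>(I, J). (-1) ^ inversions I J * a I * b J * ?G (I \<union> J) L"
  have fin: "finite K" if "K \<in> ?S" for K using that by (auto intro: finite_subset)
  have "wedge (ext_map r g a) (ext_map r g b) L =
      (\<Sum>J\<in>?S. \<Sum>I\<in>?S. a I * b J * wedge (?G I) (?G J) L)"
    unfolding ext_map_eq wedge_sum_left wedge_sum_right wedge_scale_left wedge_scale_right
    by (simp add: sum_apply sum_distrib_left mult_ac)
  also have "\<dots> = (\<Sum>I\<in>?S. \<Sum>J\<in>?S. a I * b J * wedge (?G I) (?G J) L)"
    by (rule sum.swap)
  also have "\<dots> = (\<Sum>I\<in>?S. \<Sum>J\<in>?S. if I \<inter> J = {} then ?f (I, J) else 0)"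
    by (intro sum.cong refl) (auto simp: column_wedge_mult fin)
  also have "\<dots> = (\<Sum>p\<in>?S \<times> ?S. if fst p \<inter> snd p = {} then ?f p else 0)"
    unfolding sum.cartesian_product by (rule sum.cong) (simp_all split: prod.split)
  also have "\<dots> = (\<Sum>p\<in>{p \<in> ?S \<times> ?S. fst p \<inter> snd p = {}}. ?f p)"
    by (rule sum.inter_filter[symmetric]) auto
  also have "\<dots> = (\<Sum>(K, I)\<in>Sigma ?S Pow. ?f (I, K - I))"
  proof (rule sum.reindex_bij_witness[where i = "\<lambda>(K, I). (I, K - I)" and j = "\<lambda>(I, J). (I \<union> J, I)"], goal_cases)
    case (5 p)
    then obtain I J where "p = (I, J)" "I \<inter> J = {}" by auto
    then show ?case by (simp add: Un_Diff Diff_triv inf_commute)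
  qed auto
  also have "\<dots> = (\<Sum>K\<in>?S. \<Sum>I\<in>Pow K. ?f (I, K - I))"
    by (rule sum.Sigma[symmetric]) (auto simp: fin)
  also have "\<dots> = ext_map r g (wedge a b) L"
    unfolding ext_map_def column_wedge_def[symmetric] wedge_def sum_distrib_right
    by (rule sum.cong[OF refl], rule sum.cong[OF refl]) (simp add: Un_absorb1)
  finally show "ext_map r g (wedge a b) L = wedge (ext_map r g a) (ext_map r g b) L" by simp
qed

section \<open>Holomorphic functions and sections\<close>

lemma holomorphic_Cn_const: "holomorphic_Cn n W (\<lambda>z. c)"
  unfolding holomorphic_Cn_def by (auto intro!: exI[of _ "\<lambda>_ _. 0"])

lemma holomorphic_Cn_add:
  assumes "holomorphic_Cn n W f" "holomorphic_Cn n W g"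
  shows "holomorphic_Cn n W (\<lambda>z. f z + g z)"
  unfolding holomorphic_Cn_def
proof
  fix z assume "z \<in> W"
  obtain p where p: "\<And>i. i < n \<Longrightarrow> continuous (at z within W) (p i)"
      "\<And>w. w \<in> W \<Longrightarrow> f w = f z + (\<Sum>i<n. p i w * (w i - z i))"
    using assms(1) \<open>z \<in> W\<close> unfolding holomorphic_Cn_def by blast
  obtain q where q: "\<And>i. i < n \<Longrightarrow> continuous (at z within W) (q i)"
      "\<And>w. w \<in> W \<Longrightarrow> g w = g z + (\<Sum>i<n. q i w * (w i - z i))"
    using assms(2) \<open>z \<in> W\<close> unfolding holomorphic_Cn_def by blast
  show "\<exists>q. (\<forall>i<n. continuous (at z within W) (q i)) \<and>
      (\<forall>w\<in>W. f w + g w = f z + g z + (\<Sum>i<n. q i w * (w i - z i)))"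
  proof (intro exI conjI allI ballI impI)
    show "continuous (at z within W) (\<lambda>w. p i w + q i w)" if "i < n" for i
      using p(1)[OF that] q(1)[OF that] by (rule continuous_add)
    show "f w + g w = f z + g z + (\<Sum>i<n. (p i w + q i w) * (w i - z i))" if "w \<in> W" for w
      using p(2)[OF that] q(2)[OF that] by (simp add: distrib_right sum.distrib)
  qed
qed

text \<open>Needed for products, where one factor itself becomes part of the coefficient
  functions.\<close>

lemma holomorphic_Cn_continuous:
  assumes "holomorphic_Cn n W f" "z \<in> W"
  shows "continuous (at z within W) f"
proof -
  obtain p where p: "\<And>i. i < n \<Longrightarrow> continuous (at z within W) (p i)"
      "\<And>w. w \<in> W \<Longrightarrow> f w = f z + (\<Sum>i<n. p i w * (w i - z i))"
    using assms unfolding holomorphic_Cn_def by blast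
  have coord: "continuous (at z within W) (\<lambda>w. w i)" for i
  proof (rule continuous_within_subset)
    show "continuous (at z) (\<lambda>w. w i)"
      using continuous_on_product_coordinates[where 'b = complex, of i] unfolding continuous_on_eq_continuous_within by blast
  qed simp
  have "continuous (at z within W) (\<lambda>w. f z + (\<Sum>i<n. p i w * (w i - z i)))"
    by (intro continuous_add continuous_sum continuous_mult continuous_diff continuous_const p(1) coord) simp
  \<comment> \<open>The radius 1 is arbitrary, because the expansion of \<open>f\<close> holds on
    all of \<open>W\<close>.\<close>
  then show ?thesis
    by (rule continuous_transform_within[where \<delta> = 1, OF _ _ assms(2) p(2)[symmetric]]) simp
qed

lemma holomorphic_Cn_mult:
  assumes "holomorphic_Cn n W f" "holomorphic_Cn n W g"
  shows "holomorphic_Cn n W (\<lambda>z. f z * g z)"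
  unfolding holomorphic_Cn_def
proof
  fix z assume "z \<in> W"
  obtain p where p: "\<And>i. i < n \<Longrightarrow> continuous (at z within W) (p i)"
      "\<And>w. w \<in> W \<Longrightarrow> f w = f z + (\<Sum>i<n. p i w * (w i - z i))"
    using assms(1) \<open>z \<in> W\<close> unfolding holomorphic_Cn_def by blast
  obtain q where q: "\<And>i. i < n \<Longrightarrow> continuous (at z within W) (q i)"
      "\<And>w. w \<in> W \<Longrightarrow> g w = g z + (\<Sum>i<n. q i w * (w i - z i))"
    using assms(2) \<open>z \<in> W\<close> unfolding holomorphic_Cn_def by blast
  show "\<exists>q. (\<forall>i<n. continuous (at z within W) (q i)) \<and>
      (\<forall>w\<in>W. f w * g w = f z * g z + (\<Sum>i<n. q i w * (w i - z i)))"
  proof (intro exI conjI allI ballI impI)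
    \<comment> \<open>These coefficients come from splitting the increment of the product as
      \<open>(f w - f z) * g w + f z * (g w - g z)\<close>.\<close>
    show "continuous (at z within W) (\<lambda>w. p i w * g w + f z * q i w)" if "i < n" for i
      by (intro continuous_add continuous_mult continuous_const p(1) q(1) that
          holomorphic_Cn_continuous[OF assms(2) \<open>z \<in> W\<close>])
    fix w assume w: "w \<in> W"
    have "f w * g w = f z * g z + (f w - f z) * g w + f z * (g w - g z)"
      by (simp add: algebra_simps)
    also have "\<dots> = f z * g z + (\<Sum>i<n. p i w * (w i - z i)) * g w + f z * (\<Sum>i<n. q i w * (w i - z i))"
      using p(2)[OF w] q(2)[OF w] by simp
    also have "\<dots> = f z * g z + (\<Sum>i<n. (p i w * g w + f z * q i w) * (w i - z i))"
      by (simp add: ring_distribs sum.distrib sum_distrib_left sum_distrib_right mult_ac)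
    finally show "f w * g w = f z * g z + (\<Sum>i<n. (p i w * g w + f z * q i w) * (w i - z i))" .
  qed
qed

lemma holomorphic_fun_const: "holomorphic_fun n \<A> W (\<lambda>x. c)"
  by (simp add: holomorphic_fun_def holomorphic_Cn_const)

lemma holomorphic_fun_add:
  "holomorphic_fun n \<A> W f \<Longrightarrow> holomorphic_fun n \<A> W g \<Longrightarrow> holomorphic_fun n \<A> W (\<lambda>x. f x + g x)"
  by (auto simp: holomorphic_fun_def intro!: holomorphic_Cn_add)

lemma holomorphic_fun_mult:
  "holomorphic_fun n \<A> W f \<Longrightarrow> holomorphic_fun n \<A> W g \<Longrightarrow> holomorphic_fun n \<A> W (\<lambda>x. f x * g x)"
  by (auto simp: holomorphic_fun_def intro!: holomorphic_Cn_mult)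

lemma holomorphic_fun_sum:
  "(\<And>i. i \<in> A \<Longrightarrow> holomorphic_fun n \<A> W (f i)) \<Longrightarrow> holomorphic_fun n \<A> W (\<lambda>x. \<Sum>i\<in>A. f i x)"
  by (induction A rule: infinite_finite_induct)
     (auto simp: holomorphic_fun_const intro!: holomorphic_fun_add)

lemma ext_algebra_add: "a \<in> ext_algebra r \<Longrightarrow> b \<in> ext_algebra r \<Longrightarrow> a + b \<in> ext_algebra r"
proof -
  assume "a \<in> ext_algebra r" "b \<in> ext_algebra r"
  then have "a K = 0 \<and> b K = 0" if "\<not> K \<subseteq> {..<r}" for K
    using that unfolding ext_algebra_def by blast
  then have "(a + b) K = 0" if "\<not> K \<subseteq> {..<r}" for K using that by simp
  then show ?thesis unfolding ext_algebra_def by blast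
qed

text \<open>Replaces membership in \<open>ext_fibre\<close> by conditions on the single coordinates
  \<open>s x t\<close>, the form in which closure under fibrewise operations can be checked.\<close>

lemma hol_secI:
  assumes "\<And>x t. \<not> (x \<in> V \<and> t \<in> trivs B \<and> x \<in> fst t) \<Longrightarrow> s x t = 0"
    and "\<And>x t. x \<in> V \<Longrightarrow> t \<in> trivs B \<Longrightarrow> x \<in> fst t \<Longrightarrow> s x t \<in> ext_algebra (brank B)"
    and "\<And>x t t'. x \<in> V \<Longrightarrow> t \<in> trivs B \<Longrightarrow> t' \<in> trivs B \<Longrightarrow> x \<in> fst t \<Longrightarrow> x \<in> fst t' \<Longrightarrow>
      s x t' = ext_map (brank B) (transition B (snd t) (snd t') x) (s x t)"
    and "\<And>t K. t \<in> trivs B \<Longrightarrow> holomorphic_fun (basedim B) (atlas B) (V \<inter> fst t) (\<lambda>x. s x t K)"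
  shows "s \<in> hol_sec B V"
proof -
  have "s x \<in> ext_fibre B x" if "x \<in> V" for x
    unfolding ext_fibre_def
    by (intro CollectI conjI allI ballI impI; (elim conjE)?; rule assms) (use that in auto)
  moreover have "s x = 0" if "x \<notin> V" for x
    using that assms(1) by (simp add: fun_eq_iff)
  ultimately show ?thesis using assms(4) by (simp add: hol_sec_def)
qed

lemma hol_secD:
  assumes "s \<in> hol_sec B V"
  shows "\<And>x t. \<not> (x \<in> V \<and> t \<in> trivs B \<and> x \<in> fst t) \<Longrightarrow> s x t = 0"
    and "\<And>x t. x \<in> V \<Longrightarrow> t \<in> trivs B \<Longrightarrow> x \<in> fst t \<Longrightarrow> s x t \<in> ext_algebra (brank B)"
    and "\<And>x t t'. x \<in> V \<Longrightarrow> t \<in> trivs B \<Longrightarrow> t' \<in> trivs B \<Longrightarrow> x \<in> fst t \<Longrightarrow> x \<in> fst t' \<Longrightarrow>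
      s x t' = ext_map (brank B) (transition B (snd t) (snd t') x) (s x t)"
    and "\<And>t K. t \<in> trivs B \<Longrightarrow> holomorphic_fun (basedim B) (atlas B) (V \<inter> fst t) (\<lambda>x. s x t K)"
proof -
  have *: "x \<in> V \<Longrightarrow> s x \<in> ext_fibre B x" "x \<notin> V \<Longrightarrow> s x = 0" for x
    using assms by (simp_all add: hol_sec_def)
  show "s x t = 0" if "\<not> (x \<in> V \<and> t \<in> trivs B \<and> x \<in> fst t)" for x t
  proof (cases "x \<in> V")
    case True
    then show ?thesis using *(1)[of x] that unfolding ext_fibre_def by blast
  qed (simp add: *)
  show "s x t \<in> ext_algebra (brank B)" if "x \<in> V" "t \<in> trivs B" "x \<in> fst t" for x t
    using *(1)[OF that(1)] that(2,3) unfolding ext_fibre_def by blast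
  show "s x t' = ext_map (brank B) (transition B (snd t) (snd t') x) (s x t)"
    if "x \<in> V" "t \<in> trivs B" "t' \<in> trivs B" "x \<in> fst t" "x \<in> fst t'" for x t t'
    using *(1)[OF that(1)] that(2-) unfolding ext_fibre_def by blast
  show "holomorphic_fun (basedim B) (atlas B) (V \<inter> fst t) (\<lambda>x. s x t K)" if "t \<in> trivs B" for t K
    using assms that by (simp add: hol_sec_def)
qed

lemma hol_sec_add:
  assumes "s \<in> hol_sec B V" "s' \<in> hol_sec B V"
  shows "s + s' \<in> hol_sec B V"
proof (rule hol_secI, goal_cases)
  case (1 x t)
  then show ?case using assms[THEN hol_secD(1)] by simp
next
  case (2 x t)
  then show ?case using assms[THEN hol_secD(2)] by (simp add: ext_algebra_add)
next
  case (3 x t t')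
  then show ?case using assms[THEN hol_secD(3), OF 3] by (simp only: plus_fun_apply ext_map_add)
next
  case (4 t K)
  then show ?case using assms[THEN hol_secD(4)] by (simp add: holomorphic_fun_add)
qed

lemma hol_sec_scale:
  assumes "s \<in> hol_sec B V"
  shows "sec_scale c s \<in> hol_sec B V"
proof -
  have eq: "sec_scale c s x t = (\<lambda>K. c * s x t K)" for x t by (simp add: sec_scale_def)
  show ?thesis
  proof (rule hol_secI, goal_cases)
    case (1 x t)
    then show ?case using hol_secD(1)[OF assms] by (simp add: eq fun_eq_iff)
  next
    case (2 x t)
    then show ?case using hol_secD(2)[OF assms] by (simp add: eq ext_algebra_def)
  next
    case (3 x t t')
    then show ?case using hol_secD(3)[OF assms 3] by (simp only: eq ext_map_scale)
  next
    case (4 t K)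
    then show ?case unfolding eq
      using hol_secD(4)[OF assms] by (intro holomorphic_fun_mult holomorphic_fun_const) auto
  qed
qed

lemma hol_sec_component:
  assumes "s \<in> hol_sec B V"
  shows "sec_component j s \<in> hol_sec B V"
proof -
  have eq: "sec_component j s x t = (\<lambda>K. if card K = j then s x t K else 0)" for x t
    by (simp add: sec_component_def)
  show ?thesis
  proof (rule hol_secI, goal_cases)
    case (1 x t)
    then show ?case using hol_secD(1)[OF assms] by (simp add: eq fun_eq_iff)
  next
    case (2 x t)
    then show ?case using hol_secD(2)[OF assms] by (simp add: eq ext_algebra_def)
  next
    case (3 x t t')
    then show ?case using hol_secD(3)[OF assms 3] by (simp only: eq ext_map_component)
  next
    case (4 t K)
    then show ?case unfolding eq
      using hol_secD(4)[OF assms] by (cases "card K = j") (simp_all add: holomorphic_fun_const)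
  qed
qed

text \<open>The product is compatible with a change of trivialisation because \<open>ext_map\<close>
  is multiplicative; holomorphy holds because each coefficient is a sum of products of
  coefficients.\<close>

lemma hol_sec_wedge:
  assumes "s \<in> hol_sec B V" "s' \<in> hol_sec B V"
  shows "sec_wedge s s' \<in> hol_sec B V"
proof -
  have eq: "sec_wedge s s' x t = wedge (s x t) (s' x t)" for x t by (simp add: sec_wedge_def)
  show ?thesis
  proof (rule hol_secI, goal_cases)
    case (1 x t)
    then show ?case using assms[THEN hol_secD(1), OF 1] by (simp only: eq wedge_zero)
  next
    case (2 x t)
    then show ?case using assms[THEN hol_secD(2), OF 2] by (simp only: eq wedge_ext_algebra)
  next
    case (3 x t t')
    have "ext_map (brank B) (transition B (snd t) (snd t') x) (wedge (s x t) (s' x t)) =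
        wedge (s x t') (s' x t')"
      using assms[THEN hol_secD(3), OF 3] assms[THEN hol_secD(2)] 3 by (simp only: ext_map_wedge)
    then show ?case by (simp only: eq)
  next
    case (4 t K)
    then show ?case unfolding eq wedge_def
      using assms[THEN hol_secD(4)]
      by (intro holomorphic_fun_sum holomorphic_fun_mult holomorphic_fun_const) auto
  qed
qed

text \<open>The bound of all degrees by the rank is the source of nilpotency.\<close>

lemma hol_sec_support:
  assumes "s \<in> hol_sec B V" "s x t K \<noteq> 0"
  shows "card K \<le> brank B"
proof -
  have "x \<in> V \<and> t \<in> trivs B \<and> x \<in> fst t"
    using hol_secD(1)[OF assms(1), of x t] assms(2) by (metis zero_fun_apply)
  then have "K \<subseteq> {..<brank B}"
    using hol_secD(2)[OF assms(1), of x t] assms(2) by (simp add: ext_algebra_def)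
  then show ?thesis using card_mono[of "{..<brank B}" K] by simp
qed

section \<open>Graded operators on sections\<close>

lemma sec_component_apply: "sec_component j s x t K = (if card K = j then s x t K else 0)"
  by (simp add: sec_component_def)

lemma sec_scale_apply: "sec_scale c s x t K = c * s x t K"
  by (simp add: sec_scale_def)

lemma sec_component_component [simp]:
  "sec_component i (sec_component j s) = (if i = j then sec_component j s else 0)"
  by (auto simp: fun_eq_iff sec_component_apply)

lemma sec_component_zero [simp]: "sec_component j 0 = 0"
  by (simp add: fun_eq_iff sec_component_apply)

lemma sec_component_add: "sec_component j (s + s') = sec_component j s + sec_component j s'"
  by (simp add: fun_eq_iff sec_component_apply)

lemma sec_component_scale: "sec_component j (sec_scale c s) = sec_scale c (sec_component j s)"
  by (simp add: fun_eq_iff sec_component_apply sec_scale_apply)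

lemma sec_component_sum: "sec_component j (\<Sum>i\<in>A. f i) = (\<Sum>i\<in>A. sec_component j (f i))"
  using sum_comp_morphism[of "sec_component j" f A, OF sec_component_zero sec_component_add]
  by (simp add: o_def)

text \<open>Holds for arbitrary functions, since \<open>card\<close> gives every index set a degree,
  infinite ones getting 0.\<close>

lemma sec_eqI: "(\<And>j. sec_component j s = sec_component j s') \<Longrightarrow> s = s'"
  by (intro ext) (metis sec_component_apply)

lemma sec_scale_one [simp]: "sec_scale 1 s = s"
  by (simp add: fun_eq_iff sec_scale_apply)

lemma sec_scale_zero [simp]: "sec_scale 0 s = 0" "sec_scale c 0 = 0"
  by (simp_all add: fun_eq_iff sec_scale_apply)

lemma sec_scale_add: "sec_scale c (s + s') = sec_scale c s + sec_scale c s'"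
  by (simp add: fun_eq_iff sec_scale_apply ring_distribs)

lemma sec_scale_minus_one: "sec_scale (-1) s = - s"
  by (simp add: fun_eq_iff sec_scale_apply)

lemma sec_scale_sum: "sec_scale c (\<Sum>i\<in>A. f i) = (\<Sum>i\<in>A. sec_scale c (f i))"
  using sum_comp_morphism[of "sec_scale c" f A, OF sec_scale_zero(2) sec_scale_add] by (simp add: o_def)

lemma hol_sec_zero [simp]: "0 \<in> hol_sec B V"
  by (rule hol_secI) (simp_all add: ext_algebra_def ext_map_def fun_eq_iff holomorphic_fun_const)

lemma hol_sec_minus: "s \<in> hol_sec B V \<Longrightarrow> - s \<in> hol_sec B V"
  using hol_sec_scale[of s B V "-1"] by (simp add: sec_scale_minus_one)

lemma hol_sec_diff: "s \<in> hol_sec B V \<Longrightarrow> s' \<in> hol_sec B V \<Longrightarrow> s - s' \<in> hol_sec B V"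
  using hol_sec_add[of s B V "- s'"] by (simp add: hol_sec_minus)

lemma hol_sec_sum: "(\<And>i. i \<in> A \<Longrightarrow> f i \<in> hol_sec B V) \<Longrightarrow> (\<Sum>i\<in>A. f i) \<in> hol_sec B V"
  by (induction A rule: infinite_finite_induct) (simp_all add: hol_sec_add)

lemmas hol_sec_closed = hol_sec_add hol_sec_scale hol_sec_minus hol_sec_diff hol_sec_component

lemma sec_component_vanish:
  assumes "s \<in> hol_sec B V" "brank B < j"
  shows "sec_component j s = 0"
proof (intro ext)
  fix x t K show "sec_component j s x t K = 0 x t K"
    using hol_sec_support[OF assms(1), of x t K] assms(2)
    by (cases "s x t K = 0") (auto simp: sec_component_apply)
qed

text \<open>The upper limit \<open>N\<close> is left free because \<open>homog_part_comp\<close>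
  decomposes over a range reaching beyond the rank.\<close>

lemma sec_component_decomp:
  assumes "s \<in> hol_sec B V" "brank B \<le> N"
  shows "(\<Sum>j\<le>N. sec_component j s) = s"
proof (rule sec_eqI)
  fix l
  have "sec_component l (\<Sum>j\<le>N. sec_component j s) = (\<Sum>j\<le>N. if j = l then sec_component l s else 0)"
    unfolding sec_component_sum by (rule sum.cong) auto
  also have "\<dots> = sec_component l s"
    using sec_component_vanish[OF assms(1), of l] assms(2) by simp
  finally show "sec_component l (\<Sum>j\<le>N. sec_component j s) = sec_component l s" .
qed

text \<open>Relative to holomorphic sections over one open set, since nothing is known about an
  operator elsewhere. For this reason later identities are stated for
  \<open>s \<in> hol_sec B V\<close> and not as equalities of functions.\<close>

definition sec_linear :: "('m, 'e) vbundle \<Rightarrow> 'm set \<Rightarrow> (('m, 'e) sec \<Rightarrow> ('m, 'e) sec) \<Rightarrow> bool"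
  where "sec_linear B V f \<longleftrightarrow>
    (\<forall>s\<in>hol_sec B V. f s \<in> hol_sec B V) \<and>
    (\<forall>s\<in>hol_sec B V. \<forall>s'\<in>hol_sec B V. f (s + s') = f s + f s') \<and>
    (\<forall>c. \<forall>s\<in>hol_sec B V. f (sec_scale c s) = sec_scale c (f s))"

lemma sec_linearD:
  assumes "sec_linear B V f" "s \<in> hol_sec B V"
  shows "f s \<in> hol_sec B V"
    and "s' \<in> hol_sec B V \<Longrightarrow> f (s + s') = f s + f s'"
    and "f (sec_scale c s) = sec_scale c (f s)"
  using assms by (auto simp: sec_linear_def)

lemma sec_linear_zero: "sec_linear B V f \<Longrightarrow> f 0 = 0"
  using sec_linearD(3)[of B V f 0 0] by simp

lemma sec_linear_minus: "sec_linear B V f \<Longrightarrow> s \<in> hol_sec B V \<Longrightarrow> f (- s) = - f s"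
  using sec_linearD(3)[of B V f s "-1"] by (simp add: sec_scale_minus_one)

lemma sec_linear_diff:
  "sec_linear B V f \<Longrightarrow> s \<in> hol_sec B V \<Longrightarrow> s' \<in> hol_sec B V \<Longrightarrow> f (s - s') = f s - f s'"
  using sec_linearD(2)[of B V f s "- s'"] sec_linear_minus[of B V f s'] hol_sec_minus[of s' B V]
  by (metis add_uminus_conv_diff)

lemma sec_linear_sum:
  assumes "sec_linear B V f" "\<And>i. i \<in> A \<Longrightarrow> g i \<in> hol_sec B V"
  shows "f (\<Sum>i\<in>A. g i) = (\<Sum>i\<in>A. f (g i))"
  using assms(2)
  by (induction A rule: infinite_finite_induct)
     (simp_all add: sec_linear_zero[OF assms(1)] sec_linearD(2)[OF assms(1)] hol_sec_sum)

lemma sec_linear_decomp: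
  assumes "sec_linear B V f" "s \<in> hol_sec B V" "brank B \<le> N"
  shows "f s = (\<Sum>j\<le>N. f (sec_component j s))"
  using sec_linear_sum[OF assms(1), of "{..N}" "\<lambda>j. sec_component j s"] assms(2,3)
  by (simp add: sec_component_decomp hol_sec_component)

lemma sec_linear_id: "sec_linear B V (\<lambda>s. s)"
  by (simp add: sec_linear_def)

lemma sec_linear_comp: "sec_linear B V f \<Longrightarrow> sec_linear B V g \<Longrightarrow> sec_linear B V (\<lambda>s. f (g s))"
  by (simp add: sec_linear_def)

lemma sec_linear_add: "sec_linear B V f \<Longrightarrow> sec_linear B V g \<Longrightarrow> sec_linear B V (\<lambda>s. f s + g s)"
  by (simp add: sec_linear_def hol_sec_add sec_scale_add)

lemma sec_linear_scale: "sec_linear B V f \<Longrightarrow> sec_linear B V (\<lambda>s. sec_scale c (f s))"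
  by (simp add: sec_linear_def hol_sec_scale sec_scale_add)
     (simp add: fun_eq_iff sec_scale_apply mult_ac)

lemma sec_linear_Sum:
  assumes "\<And>i. i \<in> A \<Longrightarrow> sec_linear B V (f i)"
  shows "sec_linear B V (\<lambda>s. \<Sum>i\<in>A. f i s)"
  using assms
  by (simp add: sec_linear_def hol_sec_sum sum.distrib sec_scale_sum)

lemma sec_linear_funpow: "sec_linear B V f \<Longrightarrow> sec_linear B V (f ^^ m)"
proof (induction m)
  case 0 show ?case by (simp add: sec_linear_def)
next
  case (Suc m)
  then show ?case using sec_linear_comp[of B V f "f ^^ m"] by (simp add: o_def)
qed

text \<open>\<open>deg_ge\<close> refers to the filtration by degree, \<open>deg_eq\<close> to the
  grading. Exponentials of homogeneous operators are in general no longer homogeneous, but they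
  still respect the filtration.\<close>

definition deg_ge :: "('m, 'e) vbundle \<Rightarrow> 'm set \<Rightarrow> nat \<Rightarrow> (('m, 'e) sec \<Rightarrow> ('m, 'e) sec) \<Rightarrow> bool"
  where "deg_ge B V d f \<longleftrightarrow>
    (\<forall>s\<in>hol_sec B V. \<forall>i j. i < j + d \<longrightarrow> sec_component i (f (sec_component j s)) = 0)"

definition deg_eq :: "('m, 'e) vbundle \<Rightarrow> 'm set \<Rightarrow> nat \<Rightarrow> (('m, 'e) sec \<Rightarrow> ('m, 'e) sec) \<Rightarrow> bool"
  where "deg_eq B V d f \<longleftrightarrow>
    (\<forall>s\<in>hol_sec B V. \<forall>j. sec_component (j + d) (f (sec_component j s)) = f (sec_component j s))"

lemma deg_eq_component:
  assumes "deg_eq B V d f" "s \<in> hol_sec B V"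
  shows "sec_component i (f (sec_component j s)) = (if i = j + d then f (sec_component j s) else 0)"
proof -
  have "sec_component (j + d) (f (sec_component j s)) = f (sec_component j s)"
    using assms unfolding deg_eq_def by blast
  then show ?thesis
    using sec_component_component[of i "j + d" "f (sec_component j s)"] by argo
qed

lemma deg_eq_imp_ge: "deg_eq B V d f \<Longrightarrow> e \<le> d \<Longrightarrow> deg_ge B V e f"
  by (simp add: deg_ge_def deg_eq_component)

lemma deg_ge_mono: "deg_ge B V d f \<Longrightarrow> e \<le> d \<Longrightarrow> deg_ge B V e f"
  by (simp add: deg_ge_def)

lemma deg_ge_add: "deg_ge B V d f \<Longrightarrow> deg_ge B V d g \<Longrightarrow> deg_ge B V d (\<lambda>s. f s + g s)"
  by (simp add: deg_ge_def sec_component_add)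

lemma deg_ge_scale: "deg_ge B V d f \<Longrightarrow> deg_ge B V d (\<lambda>s. sec_scale c (f s))"
  by (simp add: deg_ge_def sec_component_scale)

lemma deg_ge_Sum: "(\<And>i. i \<in> A \<Longrightarrow> deg_ge B V d (f i)) \<Longrightarrow> deg_ge B V d (\<lambda>s. \<Sum>i\<in>A. f i s)"
  by (simp add: deg_ge_def sec_component_sum)

lemma deg_ge_comp:
  assumes "sec_linear B V f" "sec_linear B V g" "deg_ge B V d f" "deg_ge B V e g"
  shows "deg_ge B V (d + e) (\<lambda>s. f (g s))"
  unfolding deg_ge_def
proof (intro ballI allI impI)
  fix s i j assume s: "s \<in> hol_sec B V" and i: "i < j + (d + e)"
  let ?y = "g (sec_component j s)"
  have y: "?y \<in> hol_sec B V" using s by (simp add: sec_linearD(1)[OF assms(2)] hol_sec_component)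
  have "sec_component i (f (sec_component k ?y)) = 0" for k
  proof (cases "k < j + e")
    case True
    then show ?thesis
      using assms(4) s by (simp add: deg_ge_def sec_linear_zero[OF assms(1)])
  next
    case False
    then show ?thesis using assms(3) y i by (simp add: deg_ge_def)
  qed
  then show "sec_component i (f ?y) = 0"
    by (simp add: sec_linear_decomp[OF assms(1) y order_refl] sec_component_sum)
qed

lemma deg_ge_funpow:
  assumes "sec_linear B V f" "deg_ge B V d f"
  shows "deg_ge B V (m * d) (f ^^ m)"
proof (induction m)
  case 0 show ?case by (simp add: deg_ge_def)
next
  case (Suc m)
  then show ?case
    using deg_ge_comp[OF assms(1) sec_linear_funpow[OF assms(1)] assms(2) Suc] by (simp add: o_def)
qed

text \<open>Components of the image below degree \<open>d\<close> vanish by the filtration, those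
  from \<open>d\<close> on because they exceed the rank.\<close>

lemma deg_ge_vanish:
  assumes "sec_linear B V f" "deg_ge B V d f" "s \<in> hol_sec B V" "brank B < d"
  shows "f s = 0"
proof (rule sec_eqI)
  fix i
  have "sec_component i (f s) = 0"
  proof (cases "i < d")
    case True
    then show ?thesis
      using assms(2,3) by (simp add: sec_linear_decomp[OF assms(1,3) order_refl] sec_component_sum deg_ge_def)
  next
    case False
    then show ?thesis using sec_component_vanish[OF sec_linearD(1)[OF assms(1,3)]] assms(4) by simp
  qed
  then show "sec_component i (f s) = sec_component i 0" by simp
qed

text \<open>The sum in \<open>pr\<close> over a single open set, freed from the case distinction so
  that it can be applied to compositions and sums of operators.\<close>

definition homog_part :: "('m, 'e) vbundle \<Rightarrow> nat \<Rightarrow> (('m, 'e) sec \<Rightarrow> ('m, 'e) sec) \<Rightarrow>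
    ('m, 'e) sec \<Rightarrow> ('m, 'e) sec"
  where "homog_part B n f s = (\<Sum>j\<le>brank B. sec_component (j + n) (f (sec_component j s)))"

lemma homog_part_cong:
  assumes "\<And>s. s \<in> hol_sec B V \<Longrightarrow> f s = g s" "s \<in> hol_sec B V"
  shows "homog_part B n f s = homog_part B n g s"
  by (simp add: homog_part_def assms hol_sec_component)

lemma homog_part_closed:
  assumes "sec_linear B V f" "s \<in> hol_sec B V"
  shows "homog_part B n f s \<in> hol_sec B V"
  unfolding homog_part_def
  by (intro hol_sec_sum hol_sec_component sec_linearD(1)[OF assms(1)] assms(2))

lemma homog_part_zero: "sec_linear B V f \<Longrightarrow> homog_part B n f 0 = 0"
  by (simp only: homog_part_def sec_component_zero sec_linear_zero sum.neutral_const)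

lemma homog_part_add: "homog_part B n (\<lambda>s. f s + g s) s = homog_part B n f s + homog_part B n g s"
  by (simp add: homog_part_def sec_component_add sum.distrib)

lemma homog_part_scale: "homog_part B n (\<lambda>s. sec_scale c (f s)) s = sec_scale c (homog_part B n f s)"
  by (simp add: homog_part_def sec_component_scale sec_scale_sum)

lemma homog_part_Sum: "homog_part B n (\<lambda>s. \<Sum>i\<in>A. f i s) s = (\<Sum>i\<in>A. homog_part B n (f i) s)"
  unfolding homog_part_def sec_component_sum by (rule sum.swap)

lemma homog_part_deg_ge:
  "deg_ge B V d f \<Longrightarrow> s \<in> hol_sec B V \<Longrightarrow> n < d \<Longrightarrow> homog_part B n f s = 0"
  by (simp add: homog_part_def deg_ge_def)

lemma homog_part_deg_eq:
  assumes "sec_linear B V f" "deg_eq B V d f" "s \<in> hol_sec B V"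
  shows "homog_part B n f s = (if n = d then f s else 0)"
  by (simp add: homog_part_def deg_eq_component[OF assms(2,3)]
      sec_linear_decomp[OF assms(1,3) order_refl])

lemma homog_part_component:
  assumes "sec_linear B V f" "s \<in> hol_sec B V"
  shows "sec_component l (homog_part B n f s) =
    (if n \<le> l then sec_component l (f (sec_component (l - n) s)) else 0)"
proof -
  have "sec_component l (homog_part B n f s) =
      (\<Sum>j\<le>brank B. if n \<le> l \<and> j = l - n then sec_component l (f (sec_component (l - n) s)) else 0)"
    unfolding homog_part_def sec_component_sum by (rule sum.cong) auto
  also have "\<dots> = (if n \<le> l \<and> l - n \<le> brank B then sec_component l (f (sec_component (l - n) s)) else 0)"
    by auto
  also have "\<dots> = (if n \<le> l then sec_component l (f (sec_component (l - n) s)) else 0)"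
    using sec_component_vanish[OF assms(2), of "l - n"] by (auto simp: sec_linear_zero[OF assms(1)])
  finally show ?thesis .
qed

text \<open>A Cauchy product: neither factor lowers degrees, so a total shift by \<open>n\<close>
  can only split into shifts \<open>i\<close> and \<open>n - i\<close> with \<open>i\<close> between
  0 and \<open>n\<close>.\<close>

lemma homog_part_comp:
  assumes f: "sec_linear B V f" "deg_ge B V 0 f" and g: "sec_linear B V g" "deg_ge B V 0 g"
    and s: "s \<in> hol_sec B V"
  shows "homog_part B n (\<lambda>s. f (g s)) s = (\<Sum>i\<le>n. homog_part B (n - i) f (homog_part B i g s))"
proof (rule sec_eqI)
  fix l
  let ?rhs = "\<Sum>i\<le>n. homog_part B (n - i) f (homog_part B i g s)"
  have rhs: "sec_component l ?rhs =
      (\<Sum>i\<le>n. if n - i \<le> l then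
         sec_component l (f (sec_component (l - (n - i)) (homog_part B i g s))) else 0)"
    by (simp add: sec_component_sum homog_part_component[OF f(1)] homog_part_closed[OF g(1) s])
  have lhs: "sec_component l (homog_part B n (\<lambda>s. f (g s)) s) =
      (if n \<le> l then sec_component l (f (g (sec_component (l - n) s))) else 0)"
    by (rule homog_part_component[OF sec_linear_comp[OF f(1) g(1)] s])
  show "sec_component l (homog_part B n (\<lambda>s. f (g s)) s) = sec_component l ?rhs"
  proof (cases "n \<le> l")
    case False
    then have "sec_component l ?rhs = 0"
      unfolding rhs
      by (intro sum.neutral) (auto simp: homog_part_component[OF g(1) s] sec_linear_zero[OF f(1)])
    then show ?thesis using False by (simp add: lhs)
  next
    case True
    define m where "m = l - n"
    have l: "l = m + n" using True by (simp add: m_def)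
    let ?y = "g (sec_component m s)"
    let ?c = "\<lambda>k. sec_component l (f (sec_component k ?y))"
    have y: "?y \<in> hol_sec B V" using s by (simp add: sec_linearD(1)[OF g(1)] hol_sec_component)
    \<comment> \<open>\<open>g\<close> does not lower degrees, which excludes \<open>k < m\<close>;
      neither does \<open>f\<close>, so nothing of degree \<open>k > l\<close> can land in degree
      \<open>l\<close>.\<close>
    have out: "?c k = 0" if "k \<notin> {m..l}" for k
    proof (cases "k < m")
      case True
      then show ?thesis using g(2) s by (simp add: deg_ge_def sec_linear_zero[OF f(1)])
    next
      case False
      then show ?thesis using f(2) y that by (simp add: deg_ge_def)
    qed
    \<comment> \<open>The bound \<open>brank B + l\<close> is at least the rank, as the
      decomposition requires, and at least \<open>l\<close>, so that the range contains
      \<open>{m..l}\<close>.\<close>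
    have "sec_component l (f ?y) = (\<Sum>k\<le>brank B + l. ?c k)"
      by (subst sec_linear_decomp[OF f(1) y, of "brank B + l"]) (simp_all add: sec_component_sum)
    also have "\<dots> = (\<Sum>k\<in>{m..l}. ?c k)"
      by (rule sum.mono_neutral_right) (use out in auto)
    also have "\<dots> = (\<Sum>i\<le>n. ?c (m + i))"
      by (rule sum.reindex_bij_witness[where i = "\<lambda>i. m + i" and j = "\<lambda>k. k - m"]) (auto simp: l)
    also have "\<dots> = sec_component l ?rhs"
      unfolding rhs by (rule sum.cong) (auto simp: l homog_part_component[OF g(1) s])
    finally have "sec_component l (f ?y) = sec_component l ?rhs" .
    then show ?thesis using True by (simp only: lhs m_def if_True)
  qed
qed

text \<open>Every application raises the degree by at least 1, so powers beyond the rank vanish. The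
  free \<open>N\<close> permits cutting the series later than at the rank.\<close>

lemma oper_exp_finite:
  assumes "sec_linear B V (F V)" "deg_ge B V d (F V)" "0 < d" "s \<in> hol_sec B V" "brank B \<le> N"
  shows "oper_exp F V s = (\<Sum>m\<le>N. sec_scale (1 / fact m) ((F V ^^ m) s))"
proof (intro ext)
  fix x t K
  have "(F V ^^ m) s = 0" if "N < m" for m
  proof (rule deg_ge_vanish[where f = "F V ^^ m" and d = "m * d" and B = B and V = V])
    have "m * 1 \<le> m * d" using assms(3) by (intro mult_le_mono) auto
    then show "brank B < m * d" using that assms(5) by linarith
  qed (use assms in \<open>auto intro: sec_linear_funpow deg_ge_funpow\<close>)
  then have "(\<Sum>m. (F V ^^ m) s x t K / fact m) = (\<Sum>m\<le>N. (F V ^^ m) s x t K / fact m)"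
    by (intro suminf_finite) auto
  then show "oper_exp F V s x t K = (\<Sum>m\<le>N. sec_scale (1 / fact m) ((F V ^^ m) s)) x t K"
    by (simp add: oper_exp_def sum_apply sec_scale_apply)
qed

section \<open>Homogeneous parts of products of exponentials\<close>

lemma sec_linear_cong:
  assumes "sec_linear B V g" "\<And>s. s \<in> hol_sec B V \<Longrightarrow> f s = g s"
  shows "sec_linear B V f"
  using assms by (simp add: sec_linear_def hol_sec_add hol_sec_scale)

lemma deg_ge_cong:
  assumes "deg_ge B V d g" "\<And>s. s \<in> hol_sec B V \<Longrightarrow> f s = g s"
  shows "deg_ge B V d f"
  using assms by (simp add: deg_ge_def hol_sec_component)

text \<open>The fourth and higher powers start in degree 8, hence the bound on \<open>n\<close> and
  the three powers that remain.\<close>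

lemma homog_part_exp:
  assumes "sec_linear B V (F V)" "deg_ge B V 2 (F V)" "s \<in> hol_sec B V" "n < 8"
  shows "homog_part B n (oper_exp F V) s =
    (if n = 0 then s else 0) + homog_part B n (F V) s +
    sec_scale (1 / 2) (homog_part B n (\<lambda>s. F V (F V s)) s) +
    sec_scale (1 / 6) (homog_part B n (\<lambda>s. F V (F V (F V s))) s)"
proof -
  \<comment> \<open>Three more than the rank, so that the exponents 0 to 3 lie in the range even for
    very small rank.\<close>
  let ?N = "brank B + 3"
  let ?f = "F V"
  have "homog_part B n (oper_exp F V) s =
      homog_part B n (\<lambda>s. \<Sum>m\<le>?N. sec_scale (1 / fact m) ((?f ^^ m) s)) s"
    by (rule homog_part_cong[OF _ assms(3)])
       (use oper_exp_finite[where F = F and B = B and V = V and N = ?N, OF assms(1,2)] in auto)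
  also have "\<dots> = (\<Sum>m\<le>?N. sec_scale (1 / fact m) (homog_part B n (?f ^^ m) s))"
    by (simp only: homog_part_Sum homog_part_scale)
  also have "\<dots> = (\<Sum>m\<le>3. sec_scale (1 / fact m) (homog_part B n (?f ^^ m) s))"
  proof (rule sum.mono_neutral_right)
    show "\<forall>m\<in>{..?N} - {..3}. sec_scale (1 / fact m) (homog_part B n (?f ^^ m) s) = 0"
    proof
      fix m assume "m \<in> {..?N} - {..3}"
      then have "n < m * 2" using assms(4) by auto
      then have "homog_part B n (?f ^^ m) s = 0"
        by (rule homog_part_deg_ge[OF deg_ge_funpow[OF assms(1,2)] assms(3)])
      then show "sec_scale (1 / fact m) (homog_part B n (?f ^^ m) s) = 0" by simp
    qed
  qed auto
  also have "\<dots> = homog_part B n (?f ^^ 0) s + homog_part B n (?f ^^ 1) s +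
      sec_scale (1 / 2) (homog_part B n (?f ^^ 2) s) + sec_scale (1 / 6) (homog_part B n (?f ^^ 3) s)"
  proof -
    have "{..3::nat} = {0, 1, 2, 3}" by auto
    moreover have "fact 2 = (2::complex)" "fact 3 = (6::complex)" by (simp_all add: eval_nat_numeral)
    ultimately show ?thesis by (simp add: add.assoc)
  qed
  also have "?f ^^ 0 = (\<lambda>s. s)" by (simp add: fun_eq_iff)
  also have "?f ^^ 1 = ?f" by simp
  also have "?f ^^ 2 = (\<lambda>s. ?f (?f s))" by (simp add: fun_eq_iff eval_nat_numeral)
  also have "?f ^^ 3 = (\<lambda>s. ?f (?f (?f s)))" by (simp add: fun_eq_iff eval_nat_numeral)
  also have "homog_part B n (\<lambda>s. s) s = (if n = 0 then s else 0)"
    by (rule homog_part_deg_eq[OF sec_linear_id _ assms(3)]) (simp add: deg_eq_def)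
  finally show ?thesis .
qed

lemma atMost_numeral_nat:
  "{..0::nat} = {0}" "{..1::nat} = {0, 1}" "{..2::nat} = {0, 1, 2}" "{..3::nat} = {0, 1, 2, 3}"
  "{..4::nat} = {0, 1, 2, 3, 4}" "{..5::nat} = {0, 1, 2, 3, 4, 5}" "{..6::nat} = {0, 1, 2, 3, 4, 5, 6}"
  by auto

text \<open>The terms are the words of total weight \<open>n\<close> in letters of weight 2 and 4.
  Odd degrees are recorded too, because the Cauchy products run over all degrees up to 6.\<close>

lemma exp_low_degree:
  assumes a2: "sec_linear B V a2" "deg_eq B V 2 a2" and a4: "sec_linear B V a4" "deg_eq B V 4 a4"
    and F: "\<And>s. s \<in> hol_sec B V \<Longrightarrow> F V s = a2 s + a4 s"
  shows "sec_linear B V (oper_exp F V)" "deg_ge B V 0 (oper_exp F V)"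
    and "s \<in> hol_sec B V \<Longrightarrow> homog_part B 0 (oper_exp F V) s = s"
    and "s \<in> hol_sec B V \<Longrightarrow> homog_part B 1 (oper_exp F V) s = 0"
    and "s \<in> hol_sec B V \<Longrightarrow> homog_part B 2 (oper_exp F V) s = a2 s"
    and "s \<in> hol_sec B V \<Longrightarrow> homog_part B 3 (oper_exp F V) s = 0"
    and "s \<in> hol_sec B V \<Longrightarrow> homog_part B 4 (oper_exp F V) s = a4 s + sec_scale (1 / 2) (a2 (a2 s))"
    and "s \<in> hol_sec B V \<Longrightarrow> homog_part B 5 (oper_exp F V) s = 0"
    and "s \<in> hol_sec B V \<Longrightarrow> homog_part B 6 (oper_exp F V) s =
      sec_scale (1 / 2) (a2 (a4 s) + a4 (a2 s)) + sec_scale (1 / 6) (a2 (a2 (a2 s)))"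
proof -
  let ?f = "F V"
  have lin: "sec_linear B V ?f"
    by (rule sec_linear_cong[OF sec_linear_add[OF a2(1) a4(1)] F])
  have ge: "deg_ge B V 2 ?f"
    by (rule deg_ge_cong[OF deg_ge_add F]) (use a2 a4 in \<open>auto intro: deg_eq_imp_ge\<close>)
  have ge0: "deg_ge B V 0 ?f" by (rule deg_ge_mono[OF ge]) simp
  note lin2 = sec_linear_comp[OF lin lin]
  have ge2: "deg_ge B V 0 (\<lambda>s. ?f (?f s))" using deg_ge_comp[OF lin lin ge0 ge0] by simp
  let ?E = "\<lambda>s. \<Sum>m\<le>brank B. sec_scale (1 / fact m) ((?f ^^ m) s)"
  have E: "oper_exp F V s = ?E s" if "s \<in> hol_sec B V" for s
    by (rule oper_exp_finite[where F = F and B = B and V = V, OF lin ge]) (use that in auto)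
  show "sec_linear B V (oper_exp F V)"
    by (rule sec_linear_cong[OF _ E]) (intro sec_linear_Sum sec_linear_scale sec_linear_funpow lin)
  show "deg_ge B V 0 (oper_exp F V)"
  proof (rule deg_ge_cong[OF _ E])
    show "deg_ge B V 0 ?E"
      by (intro deg_ge_Sum deg_ge_scale) (use deg_ge_funpow[OF lin ge0] in simp)
  qed
  have h: "homog_part B n ?f s = (if n = 2 then a2 s else 0) + (if n = 4 then a4 s else 0)"
    if "s \<in> hol_sec B V" for n s
    using homog_part_cong[OF F that, where n = n] that
    by (simp only: homog_part_add homog_part_deg_eq[OF a2] homog_part_deg_eq[OF a4])
  have h2: "homog_part B 2 ?f s = a2 s" and h4: "homog_part B 4 ?f s = a4 s"
    and h0: "n \<noteq> 2 \<Longrightarrow> n \<noteq> 4 \<Longrightarrow> homog_part B n ?f s = 0"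
    if "s \<in> hol_sec B V" for n s
    using h[OF that] by simp_all
  have ff: "homog_part B n (\<lambda>s. ?f (?f s)) s = (\<Sum>i\<le>n. homog_part B (n - i) ?f (homog_part B i ?f s))"
    if "s \<in> hol_sec B V" for n s
    by (rule homog_part_comp[OF lin ge0 lin ge0 that])
  have fff: "homog_part B n (\<lambda>s. ?f (?f (?f s))) s =
      (\<Sum>i\<le>n. homog_part B (n - i) (\<lambda>s. ?f (?f s)) (homog_part B i ?f s))"
    if "s \<in> hol_sec B V" for n s
    by (rule homog_part_comp[OF lin2 ge2 lin ge0 that])
  note z = homog_part_zero[OF lin] homog_part_zero[OF lin2]
  note cl = sec_linearD(1)[OF a2(1)] sec_linearD(1)[OF a4(1)]
  note rules = homog_part_exp[where F = F and B = B and V = V, OF lin ge] ff fff h2 h4 h0 z cl atMost_numeral_nat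
  {
    assume s: "s \<in> hol_sec B V"
    show "homog_part B 0 (oper_exp F V) s = s" by (simp add: s rules)
    show "homog_part B 1 (oper_exp F V) s = 0" by (simp add: s rules)
    show "homog_part B 2 (oper_exp F V) s = a2 s" by (simp add: s rules)
    show "homog_part B 3 (oper_exp F V) s = 0" by (simp add: s rules)
    show "homog_part B 4 (oper_exp F V) s = a4 s + sec_scale (1 / 2) (a2 (a2 s))"
      by (simp add: s rules)
    show "homog_part B 5 (oper_exp F V) s = 0" by (simp add: s rules)
    show "homog_part B 6 (oper_exp F V) s =
        sec_scale (1 / 2) (a2 (a4 s) + a4 (a2 s)) + sec_scale (1 / 6) (a2 (a2 (a2 s)))"
      by (simp add: s rules add.commute)
  }
qed

text \<open>The commutator without Koszul sign, since only operators of even degree occur.\<close>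

definition bracket :: "(('m, 'e) sec \<Rightarrow> ('m, 'e) sec) \<Rightarrow> (('m, 'e) sec \<Rightarrow> ('m, 'e) sec) \<Rightarrow>
    ('m, 'e) sec \<Rightarrow> ('m, 'e) sec"
  where "bracket f g = (\<lambda>s. f (g s) - g (f s))"

lemmas sec_linear_rules = sec_linearD sec_linear_minus sec_linear_diff

text \<open>Origin of the constants: let Z be the Baker-Campbell-Hausdorff series of
  \<open>a2 + a4\<close> and \<open>b2 + b4\<close>, so that Z_2 = a2 + b2 and Z_4 = a4 + b4 + 1/2
  [a2, b2]. If c2 = -Z_2 and c4 = -Z_4, the commutators with the third factor cancel and Z_6
  remains, whose cubic terms carry 1/12 and -1/12. If all degree-4 inputs vanish, the third factor
  leaves Z_6 + 1/2 [Z_2, Z_4], which gives 1/12 + 1/4 = 1/3 and -1/12 + 1/4 = 1/6.\<close>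

lemma exp_triple_low_degree:
  fixes a2 a4 b2 b4 c2 c4 :: "('m, 'e) sec \<Rightarrow> ('m, 'e) sec" and Fa Fb Fc :: "('m, 'e) oper"
  assumes a2: "sec_linear B V a2" "deg_eq B V 2 a2" and a4: "sec_linear B V a4" "deg_eq B V 4 a4"
    and b2: "sec_linear B V b2" "deg_eq B V 2 b2" and b4: "sec_linear B V b4" "deg_eq B V 4 b4"
    and c2: "sec_linear B V c2" "deg_eq B V 2 c2" and c4: "sec_linear B V c4" "deg_eq B V 4 c4"
    and Fa: "\<And>s. s \<in> hol_sec B V \<Longrightarrow> Fa V s = a2 s + a4 s"
    and Fb: "\<And>s. s \<in> hol_sec B V \<Longrightarrow> Fb V s = b2 s + b4 s"
    and Fc: "\<And>s. s \<in> hol_sec B V \<Longrightarrow> Fc V s = c2 s + c4 s"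
    and sum2: "\<And>s. s \<in> hol_sec B V \<Longrightarrow> c2 s = - a2 s - b2 s"
    and s: "s \<in> hol_sec B V"
  defines "D \<equiv> \<lambda>s. oper_exp Fa V (oper_exp Fb V (oper_exp Fc V s))"
  shows "homog_part B 4 D s = a4 s + b4 s + c4 s + sec_scale (1 / 2) (bracket a2 b2 s)"
    and "(\<And>s. s \<in> hol_sec B V \<Longrightarrow> c4 s = - a4 s - b4 s - sec_scale (1 / 2) (bracket a2 b2 s)) \<Longrightarrow>
      homog_part B 6 D s = sec_scale (1 / 2) (bracket a2 b4 s + bracket a4 b2 s) +
        sec_scale (1 / 12) (bracket a2 (bracket a2 b2) s - bracket b2 (bracket a2 b2) s)"
    and "(\<And>s. s \<in> hol_sec B V \<Longrightarrow> a4 s = 0 \<and> b4 s = 0 \<and> c4 s = 0) \<Longrightarrow>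
      homog_part B 6 D s = sec_scale (1 / 3) (bracket a2 (bracket a2 b2) s) +
        sec_scale (1 / 6) (bracket b2 (bracket a2 b2) s)"
proof -
  note Ea = exp_low_degree[where F = Fa, OF a2 a4 Fa]
  note Eb = exp_low_degree[where F = Fb, OF b2 b4 Fb]
  note Ec = exp_low_degree[where F = Fc, OF c2 c4 Fc]
  note linbc = sec_linear_comp[OF Eb(1) Ec(1)]
  have gebc: "deg_ge B V 0 (\<lambda>s. oper_exp Fb V (oper_exp Fc V s))"
    using deg_ge_comp[OF Eb(1) Ec(1) Eb(2) Ec(2)] by simp
  have D: "homog_part B n D s = (\<Sum>i\<le>n. homog_part B (n - i) (oper_exp Fa V)
      (\<Sum>j\<le>i. homog_part B (i - j) (oper_exp Fb V) (homog_part B j (oper_exp Fc V) s)))" for n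
    unfolding D_def using homog_part_comp[OF Ea(1,2) linbc gebc s]
    by (simp add: homog_part_comp[OF Eb(1,2) Ec(1,2) s])
  note lin = sec_linear_rules[OF a2(1)] sec_linear_rules[OF a4(1)] sec_linear_rules[OF b2(1)]
    sec_linear_rules[OF b4(1)] sec_linear_rules[OF c2(1)] sec_linear_rules[OF c4(1)]
  note z = sec_linear_zero[OF a2(1)] sec_linear_zero[OF a4(1)] sec_linear_zero[OF b2(1)]
    sec_linear_zero[OF b4(1)] sec_linear_zero[OF c2(1)] sec_linear_zero[OF c4(1)]
  note parts = Ea(3-)[unfolded One_nat_def] Eb(3-)[unfolded One_nat_def] Ec(3-)[unfolded One_nat_def]
    homog_part_zero[OF Ea(1)] homog_part_zero[OF Eb(1)]
  have D4: "homog_part B 4 D s =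
      c4 s + sec_scale (1 / 2) (c2 (c2 s)) + b2 (c2 s) + b4 s + sec_scale (1 / 2) (b2 (b2 s)) +
      a2 (b2 s + c2 s) + a4 s + sec_scale (1 / 2) (a2 (a2 s))"
    unfolding D atMost_numeral_nat
    by (simp add: parts lin z s hol_sec_closed atMost_numeral_nat add_ac)
  have D6: "homog_part B 6 D s =
      sec_scale (1 / 2) (c2 (c4 s) + c4 (c2 s)) + sec_scale (1 / 6) (c2 (c2 (c2 s))) +
      b2 (c4 s + sec_scale (1 / 2) (c2 (c2 s))) +
      (b4 (c2 s) + sec_scale (1 / 2) (b2 (b2 (c2 s)))) +
      sec_scale (1 / 2) (b2 (b4 s) + b4 (b2 s)) + sec_scale (1 / 6) (b2 (b2 (b2 s))) +
      a2 (c4 s + sec_scale (1 / 2) (c2 (c2 s)) + b2 (c2 s) + b4 s + sec_scale (1 / 2) (b2 (b2 s))) +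
      (a4 (b2 s + c2 s) + sec_scale (1 / 2) (a2 (a2 (b2 s + c2 s)))) +
      sec_scale (1 / 2) (a2 (a4 s) + a4 (a2 s)) + sec_scale (1 / 6) (a2 (a2 (a2 s)))"
    unfolding D atMost_numeral_nat
    by (simp add: parts lin z s hol_sec_closed atMost_numeral_nat add_ac)
  \<comment> \<open>Once \<open>c2\<close> is eliminated, both sides are linear combinations of
    words applied to \<open>s\<close>. Linearity expands them, and evaluation at \<open>x\<close>,
    \<open>t\<close>, \<open>K\<close> turns the comparison into one of complex numbers. The two
    degree-6 formulas are verified in the same way.\<close>
  show "homog_part B 4 D s = a4 s + b4 s + c4 s + sec_scale (1 / 2) (bracket a2 b2 s)"
    unfolding D4 bracket_def
    by (intro ext) (simp add: sum2 lin s hol_sec_closed sec_scale_apply field_simps)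
  show "homog_part B 6 D s = sec_scale (1 / 2) (bracket a2 b4 s + bracket a4 b2 s) +
        sec_scale (1 / 12) (bracket a2 (bracket a2 b2) s - bracket b2 (bracket a2 b2) s)"
    if "\<And>s. s \<in> hol_sec B V \<Longrightarrow> c4 s = - a4 s - b4 s - sec_scale (1 / 2) (bracket a2 b2 s)"
    unfolding D6 bracket_def
    by (intro ext) (simp add: that[unfolded bracket_def] sum2 lin s hol_sec_closed sec_scale_apply field_simps)
  show "homog_part B 6 D s = sec_scale (1 / 3) (bracket a2 (bracket a2 b2) s) +
        sec_scale (1 / 6) (bracket b2 (bracket a2 b2) s)"
    if "\<And>s. s \<in> hol_sec B V \<Longrightarrow> a4 s = 0 \<and> b4 s = 0 \<and> c4 s = 0"
    using that unfolding D6 bracket_def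
    by (intro ext) (simp add: sum2 lin s hol_sec_closed sec_scale_apply field_simps)
qed

section \<open>Derivations of even degree\<close>

lemma EndD:
  assumes "f \<in> End B U" "openin (base B) V" "V \<subseteq> U"
  shows "sec_linear B V (f V)"
    and "\<And>V' s. openin (base B) V' \<Longrightarrow> V' \<subseteq> V \<Longrightarrow> s \<in> hol_sec B V \<Longrightarrow>
      f V' (sec_restrict V' s) = sec_restrict V' (f V s)"
proof -
  note * = assms(1)[unfolded End_def mem_Collect_eq, THEN conjunct2, THEN spec, THEN mp,
      OF conjI[OF assms(2,3)]]
  show "sec_linear B V (f V)"
    unfolding sec_linear_def image_subset_iff[symmetric] using * by (elim conjE, intro conjI)
  show "f V' (sec_restrict V' s) = sec_restrict V' (f V s)"
    if "openin (base B) V'" "V' \<subseteq> V" "s \<in> hol_sec B V" for V' s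
    using *[THEN conjunct2, THEN conjunct2, THEN conjunct2, THEN conjunct2, THEN conjunct2,
        THEN spec, THEN mp, OF conjI[OF that(1,2)]] that(3) by (rule bspec)
qed

lemma component_hol_sec_deg:
  "s \<in> hol_sec B V \<Longrightarrow> sec_component j s \<in> hol_sec_deg B (\<lambda>m. m = j) V"
  by (simp add: hol_sec_deg_def hol_sec_component sec_component_apply)

lemma hol_sec_deg_eq_component: "s \<in> hol_sec_deg B (\<lambda>m. m = j) V \<Longrightarrow> sec_component j s = s"
  by (intro ext) (auto simp: hol_sec_deg_def sec_component_apply)

lemma End_deg_deg_eq:
  assumes "f \<in> End_deg B d U" "openin (base B) V" "V \<subseteq> U"
  shows "deg_eq B V d (f V)"
  unfolding deg_eq_def
proof (intro ballI allI)
  fix s j assume "s \<in> hol_sec B V"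
  then have "sec_component j s \<in> hol_sec_deg B (\<lambda>m. m = j) V" by (rule component_hol_sec_deg)
  moreover have "f V ` hol_sec_deg B (\<lambda>m. m = j) V \<subseteq> hol_sec_deg B (\<lambda>m. m = j + d) V"
    using assms unfolding End_deg_def by blast
  ultimately have "f V (sec_component j s) \<in> hol_sec_deg B (\<lambda>m. m = j + d) V" by blast
  then show "sec_component (j + d) (f V (sec_component j s)) = f V (sec_component j s)"
    by (rule hol_sec_deg_eq_component)
qed

lemma hol_sec_deg_iff:
  "s \<in> hol_sec_deg B P V \<longleftrightarrow> s \<in> hol_sec B V \<and> (\<forall>j. \<not> P j \<longrightarrow> sec_component j s = 0)"
proof -
  have "(\<forall>x t K. s x t K \<noteq> 0 \<longrightarrow> P (card K)) \<longleftrightarrow> (\<forall>j. \<not> P j \<longrightarrow> sec_component j s = 0)"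
    by (auto simp: fun_eq_iff sec_component_apply)
  then show ?thesis by (simp add: hol_sec_deg_def)
qed

text \<open>Arbitrary degree predicates cover at once the three inclusions required of an operator:
  for even sections, for odd sections and for sections of one exact degree.\<close>

lemma deg_eq_hol_sec_deg:
  assumes "sec_linear B V f" "deg_eq B V d f" "s \<in> hol_sec_deg B P V" "\<And>j. P j \<Longrightarrow> Q (j + d)"
  shows "f s \<in> hol_sec_deg B Q V"
proof -
  have s: "s \<in> hol_sec B V" and P: "\<not> P j \<Longrightarrow> sec_component j s = 0" for j
    using assms(3) by (auto simp: hol_sec_deg_iff)
  have "sec_component i (f s) = 0" if "\<not> Q i" for i
  proof -
    have "sec_component i (f (sec_component j s)) = 0" for j
    proof (cases "P j")
      case True
      then have "i \<noteq> j + d" using assms(4) that by blast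
      then show ?thesis by (simp add: deg_eq_component[OF assms(2) s])
    next
      case False
      then show ?thesis by (simp add: P sec_linear_zero[OF assms(1)])
    qed
    then show ?thesis
      by (subst sec_linear_decomp[OF assms(1) s order_refl]) (simp add: sec_component_sum)
  qed
  then show ?thesis using sec_linearD(1)[OF assms(1) s] by (simp add: hol_sec_deg_iff)
qed

text \<open>Homogeneity of even degree already yields the parity conditions in \<open>End\<close>.
  With the converse \<open>Der_degD\<close>, membership becomes a list of conditions that pass
  easily to sums, multiples, restrictions and brackets.\<close>

lemma Der_degI:
  assumes "even d"
    and out: "\<And>V s. \<not> (openin (base B) V \<and> V \<subseteq> U \<and> s \<in> hol_sec B V) \<Longrightarrow> f V s = 0"
    and lin: "\<And>V. openin (base B) V \<Longrightarrow> V \<subseteq> U \<Longrightarrow> sec_linear B V (f V)"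
    and deg: "\<And>V. openin (base B) V \<Longrightarrow> V \<subseteq> U \<Longrightarrow> deg_eq B V d (f V)"
    and res: "\<And>V V' s. openin (base B) V \<Longrightarrow> V \<subseteq> U \<Longrightarrow> openin (base B) V' \<Longrightarrow> V' \<subseteq> V \<Longrightarrow>
      s \<in> hol_sec B V \<Longrightarrow> f V' (sec_restrict V' s) = sec_restrict V' (f V s)"
    and leibniz: "\<And>V s s'. openin (base B) V \<Longrightarrow> V \<subseteq> U \<Longrightarrow> s \<in> hol_sec B V \<Longrightarrow> s' \<in> hol_sec B V \<Longrightarrow>
      f V (sec_wedge s s') = sec_wedge (f V s) s' + sec_wedge s (f V s')"
  shows "f \<in> Der_deg B d U"
proof -
  have sub: "f V ` hol_sec_deg B P V \<subseteq> hol_sec_deg B Q V"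
    if "openin (base B) V" "V \<subseteq> U" "\<And>j. P j \<Longrightarrow> Q (j + d)" for V P Q
  proof (rule image_subsetI)
    fix s assume "s \<in> hol_sec_deg B P V"
    then show "f V s \<in> hol_sec_deg B Q V"
      by (rule deg_eq_hol_sec_deg[OF lin[OF that(1,2)] deg[OF that(1,2)]]) (rule that(3))
  qed
  have End: "f \<in> End B U"
    unfolding End_def
  proof (intro CollectI conjI allI impI ballI, goal_cases)
    case 1
    show ?case by (intro ext) (simp add: oper_restrict_def out)
  next
    case (2 V)
    then show ?case using sec_linearD(1)[OF lin[of V]] by (intro image_subsetI) simp
  next
    case (3 V s s')
    then show ?case using sec_linearD(2)[OF lin[of V]] by simp
  next
    case (4 V c s)
    then show ?case using sec_linearD(3)[OF lin[of V]] by simp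
  next
    case (5 V)
    then show ?case using sub[of V even even] \<open>even d\<close> by auto
  next
    case (6 V)
    then show ?case using sub[of V odd odd] \<open>even d\<close> by auto
  next
    case (7 V V' s)
    then show ?case by (elim conjE, intro res)
  qed
  have homog: "f V ` hol_sec_deg B (\<lambda>m. m = j) V \<subseteq> hol_sec_deg B (\<lambda>m. m = j + d) V"
    if "openin (base B) V" "V \<subseteq> U" for V j
    using that by (rule sub) simp
  show ?thesis
    unfolding Der_deg_def Der_def End_deg_def
    by (intro IntI CollectI conjI allI impI ballI End leibniz homog; elim conjE; assumption)
qed

lemma Der_degD:
  assumes "f \<in> Der_deg B d U"
  shows "\<And>V s. \<not> (openin (base B) V \<and> V \<subseteq> U \<and> s \<in> hol_sec B V) \<Longrightarrow> f V s = 0"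
    and "\<And>V. openin (base B) V \<Longrightarrow> V \<subseteq> U \<Longrightarrow> sec_linear B V (f V)"
    and "\<And>V. openin (base B) V \<Longrightarrow> V \<subseteq> U \<Longrightarrow> deg_eq B V d (f V)"
    and "\<And>V V' s. openin (base B) V \<Longrightarrow> V \<subseteq> U \<Longrightarrow> openin (base B) V' \<Longrightarrow> V' \<subseteq> V \<Longrightarrow>
      s \<in> hol_sec B V \<Longrightarrow> f V' (sec_restrict V' s) = sec_restrict V' (f V s)"
    and "\<And>V s s'. openin (base B) V \<Longrightarrow> V \<subseteq> U \<Longrightarrow> s \<in> hol_sec B V \<Longrightarrow> s' \<in> hol_sec B V \<Longrightarrow>
      f V (sec_wedge s s') = sec_wedge (f V s) s' + sec_wedge s (f V s')"
proof -
  have f: "f \<in> Der B U" "f \<in> End B U" "f \<in> End_deg B d U"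
  proof -
    show Der: "f \<in> Der B U" and "f \<in> End_deg B d U" using assms by (simp_all only: Der_deg_def Int_iff)
    then show "f \<in> End B U" by (simp only: Der_def mem_Collect_eq)
  qed
  show "f V s = 0" if "\<not> (openin (base B) V \<and> V \<subseteq> U \<and> s \<in> hol_sec B V)" for V s
  proof -
    have "oper_restrict B U f = f" using f(2)[unfolded End_def mem_Collect_eq] by (rule conjunct1)
    then have "f V s = oper_restrict B U f V s" by simp
    then show ?thesis using that by (simp add: oper_restrict_def)
  qed
  show "sec_linear B V (f V)" if "openin (base B) V" "V \<subseteq> U" for V
    using EndD(1)[OF f(2) that] .
  show "deg_eq B V d (f V)" if "openin (base B) V" "V \<subseteq> U" for V
    using End_deg_deg_eq[OF f(3) that] .
  show "f V' (sec_restrict V' s) = sec_restrict V' (f V s)"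
    if "openin (base B) V" "V \<subseteq> U" "openin (base B) V'" "V' \<subseteq> V" "s \<in> hol_sec B V" for V V' s
    by (rule EndD(2)[OF f(2) that])
  show "f V (sec_wedge s s') = sec_wedge (f V s) s' + sec_wedge s (f V s')"
    if "openin (base B) V" "V \<subseteq> U" "s \<in> hol_sec B V" "s' \<in> hol_sec B V" for V s s'
    by (rule f(1)[unfolded Der_def mem_Collect_eq, THEN conjunct2, THEN spec, THEN mp,
        OF conjI[OF that(1,2)], THEN bspec, THEN bspec, OF that(3,4)])
qed

section \<open>Closure properties of the homogeneous derivations\<close>

lemma sec_wedge_linear:
  "sec_wedge (s + s') t = sec_wedge s t + sec_wedge s' t"
  "sec_wedge s (t + t') = sec_wedge s t + sec_wedge s t'"
  "sec_wedge (sec_scale c s) t = sec_scale c (sec_wedge s t)"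
  "sec_wedge s (sec_scale c t) = sec_scale c (sec_wedge s t)"
  by (intro ext, simp only: sec_wedge_def sec_scale_def plus_fun_apply
      wedge_add_left wedge_add_right wedge_scale_left wedge_scale_right)+

lemma sec_restrict_linear:
  "sec_restrict V (s + s') = sec_restrict V s + sec_restrict V s'"
  "sec_restrict V (s - s') = sec_restrict V s - sec_restrict V s'"
  "sec_restrict V (sec_scale c s) = sec_scale c (sec_restrict V s)"
  by (auto simp: fun_eq_iff sec_restrict_def sec_scale_apply)

definition oper_scale :: "complex \<Rightarrow> ('m, 'e) oper \<Rightarrow> ('m, 'e) oper"
  where "oper_scale c f = (\<lambda>V s. sec_scale c (f V s))"

definition oper_comm :: "('m, 'e) oper \<Rightarrow> ('m, 'e) oper \<Rightarrow> ('m, 'e) oper"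
  where "oper_comm f g = (\<lambda>V. bracket (f V) (g V))"

lemma Der_deg_zero: "even d \<Longrightarrow> 0 \<in> Der_deg B d U"
  by (rule Der_degI)
     (simp_all add: sec_linear_def deg_eq_def sec_wedge_def sec_restrict_def fun_eq_iff
       wedge_def sec_component_apply sec_scale_apply)

lemma Der_deg_add:
  assumes "even d" "f \<in> Der_deg B d U" "g \<in> Der_deg B d U"
  shows "f + g \<in> Der_deg B d U"
proof (rule Der_degI[OF assms(1)], goal_cases)
  case (1 V s)
  then show ?case using Der_degD(1)[OF assms(2)] Der_degD(1)[OF assms(3)] by simp
next
  case (2 V)
  then show ?case
    using sec_linear_add[OF Der_degD(2)[OF assms(2) 2] Der_degD(2)[OF assms(3) 2]]
    by (simp add: plus_fun_def)
next
  case (3 V)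
  then show ?case
    using Der_degD(3)[OF assms(2) 3] Der_degD(3)[OF assms(3) 3]
    by (simp add: deg_eq_def sec_component_add)
next
  case (4 V V' s)
  then show ?case
    using Der_degD(4)[OF assms(2) 4] Der_degD(4)[OF assms(3) 4] by (simp add: sec_restrict_linear)
next
  case (5 V s s')
  then show ?case
    using Der_degD(5)[OF assms(2) 5] Der_degD(5)[OF assms(3) 5] by (simp add: sec_wedge_linear add_ac)
qed

lemma Der_deg_scale:
  assumes "even d" "f \<in> Der_deg B d U"
  shows "oper_scale c f \<in> Der_deg B d U"
proof (rule Der_degI[OF assms(1)], goal_cases)
  case (1 V s)
  then show ?case using Der_degD(1)[OF assms(2) 1] by (simp add: oper_scale_def)
next
  case (2 V)
  then show ?case using sec_linear_scale[OF Der_degD(2)[OF assms(2) 2]] by (simp add: oper_scale_def)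
next
  case (3 V)
  then show ?case
    using Der_degD(3)[OF assms(2) 3] by (simp add: deg_eq_def oper_scale_def sec_component_scale)
next
  case (4 V V' s)
  then show ?case using Der_degD(4)[OF assms(2) 4] by (simp add: oper_scale_def sec_restrict_linear)
next
  case (5 V s s')
  then show ?case
    using Der_degD(5)[OF assms(2) 5] by (simp add: oper_scale_def sec_wedge_linear sec_scale_add)
qed

lemma Der_deg_diff:
  assumes "even d" "f \<in> Der_deg B d U" "g \<in> Der_deg B d U"
  shows "f - g \<in> Der_deg B d U"
proof -
  have "f - g = f + oper_scale (-1) g"
    by (simp add: fun_eq_iff oper_scale_def sec_scale_apply)
  then show ?thesis by (simp only: Der_deg_add[OF assms(1,2) Der_deg_scale[OF assms(1,3)]])
qed

lemma Der_deg_restrict: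
  assumes "even d" "f \<in> Der_deg B d U" "W \<subseteq> U"
  shows "oper_restrict B W f \<in> Der_deg B d W"
proof (rule Der_degI[OF assms(1)], goal_cases)
  case (1 V s)
  then show ?case by (auto simp: oper_restrict_def)
next
  case (2 V)
  then have "V \<subseteq> U" using assms(3) by blast
  from sec_linear_cong[OF Der_degD(2)[OF assms(2) 2(1) this]]
  show ?case using 2 by (simp add: oper_restrict_def)
next
  case (3 V)
  then have "V \<subseteq> U" using assms(3) by blast
  from Der_degD(3)[OF assms(2) 3(1) this]
  show ?case using 3 by (simp add: deg_eq_def oper_restrict_def hol_sec_component)
next
  case (4 V V' s)
  then have "V \<subseteq> U" "V' \<subseteq> U" "V' \<subseteq> W" using assms(3) by blast+
  \<comment> \<open>This also covers a restricted section that fails to lie in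
    \<open>hol_sec B V'\<close>: both sides are then 0 by extensionality.\<close>
  have "oper_restrict B W f V' (sec_restrict V' s) = f V' (sec_restrict V' s)"
    using Der_degD(1)[OF assms(2), of V' "sec_restrict V' s"] 4 \<open>V' \<subseteq> W\<close>
    by (auto simp: oper_restrict_def)
  then show ?case
    using Der_degD(4)[OF assms(2) 4(1) \<open>V \<subseteq> U\<close> 4(3-5)] 4 by (simp add: oper_restrict_def)
next
  case (5 V s s')
  then have "V \<subseteq> U" using assms(3) by blast
  from Der_degD(5)[OF assms(2) 5(1) this 5(3,4)]
  show ?case using 5 by (simp add: oper_restrict_def hol_sec_wedge)
qed

lemma deg_eq_comp:
  assumes "sec_linear B V f" "sec_linear B V g" "deg_eq B V d f" "deg_eq B V e g"
  shows "deg_eq B V (e + d) (\<lambda>s. f (g s))"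
  unfolding deg_eq_def
proof (intro ballI allI)
  fix s j assume s: "s \<in> hol_sec B V"
  let ?y = "g (sec_component j s)"
  have y: "?y \<in> hol_sec B V" using s by (simp add: sec_linearD(1)[OF assms(2)] hol_sec_component)
  have "sec_component (j + e) ?y = ?y" using assms(4) s unfolding deg_eq_def by blast
  moreover have "sec_component (j + e + d) (f (sec_component (j + e) ?y)) = f (sec_component (j + e) ?y)"
    using assms(3) y unfolding deg_eq_def by blast
  ultimately show "sec_component (j + (e + d)) (f ?y) = f ?y" by (simp add: add.assoc)
qed

lemma sec_component_diff: "sec_component j (s - s') = sec_component j s - sec_component j s'"
  by (simp add: fun_eq_iff sec_component_apply)

lemma sec_linear_bracket:
  assumes "sec_linear B V f" "sec_linear B V g"
  shows "sec_linear B V (bracket f g)"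
proof -
  have "bracket f g = (\<lambda>s. f (g s) + sec_scale (-1) (g (f s)))"
    by (simp add: bracket_def sec_scale_minus_one)
  then show ?thesis
    using sec_linear_add[OF sec_linear_comp[OF assms] sec_linear_scale[OF sec_linear_comp[OF assms(2,1)]]]
    by simp
qed

text \<open>The mixed terms \<open>sec_wedge (f V s) (g V s')\<close> and
  \<open>sec_wedge (g V s) (f V s')\<close> occur in both compositions and cancel in the difference.
  No signs interfere, because the Leibniz rule of an even derivation has none.\<close>

lemma Der_deg_comm:
  assumes "even d" "even e" "f \<in> Der_deg B d U" "g \<in> Der_deg B e U"
  shows "oper_comm f g \<in> Der_deg B (d + e) U"
proof (rule Der_degI, goal_cases)
  case 1
  show ?case using assms by simp
next
  case (2 V s)
  \<comment> \<open>Outside the domain the inner operators give 0, and the outer ones must send 0 to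
    0: by linearity if \<open>V\<close> is an open subset of \<open>U\<close>, by extensionality
    otherwise.\<close>
  have z: "f V 0 = 0" "g V 0 = 0"
    using Der_degD(1)[OF assms(3), of V 0] sec_linear_zero[OF Der_degD(2)[OF assms(3), of V]]
      Der_degD(1)[OF assms(4), of V 0] sec_linear_zero[OF Der_degD(2)[OF assms(4), of V]] by argo+
  show ?case
    using Der_degD(1)[OF assms(3) 2] Der_degD(1)[OF assms(4) 2] z
    by (simp add: oper_comm_def bracket_def)
next
  case (3 V)
  then show ?case unfolding oper_comm_def
    by (intro sec_linear_bracket Der_degD(2)[OF assms(3)] Der_degD(2)[OF assms(4)])
next
  case (4 V)
  note l = Der_degD(2)[OF assms(3) 4] Der_degD(2)[OF assms(4) 4]
  note dg = Der_degD(3)[OF assms(3) 4] Der_degD(3)[OF assms(4) 4]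
  show ?case
    using deg_eq_comp[OF l dg] deg_eq_comp[OF l(2,1) dg(2,1)]
    by (simp add: deg_eq_def oper_comm_def bracket_def sec_component_diff add.commute)
next
  case (5 V V' s)
  note l = Der_degD(2)[OF assms(3) 5(1,2)] Der_degD(2)[OF assms(4) 5(1,2)]
  have m: "f V s \<in> hol_sec B V" "g V s \<in> hol_sec B V"
    using l 5(5) by (simp_all add: sec_linear_def)
  show ?case
    using Der_degD(4)[OF assms(3) 5(1-4)] Der_degD(4)[OF assms(4) 5(1-4)] 5(5) m
    by (simp add: oper_comm_def bracket_def sec_restrict_linear)
next
  case (6 V s s')
  note l = Der_degD(2)[OF assms(3) 6(1,2)] Der_degD(2)[OF assms(4) 6(1,2)]
  note L = Der_degD(5)[OF assms(3) 6(1,2)] Der_degD(5)[OF assms(4) 6(1,2)]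
  have m: "f V s \<in> hol_sec B V" "g V s \<in> hol_sec B V" "f V s' \<in> hol_sec B V" "g V s' \<in> hol_sec B V"
    using l 6 by (simp_all add: sec_linear_def)
  have dl: "sec_wedge (a - b) c = sec_wedge a c - sec_wedge b c"
    and dr: "sec_wedge a (b - c) = sec_wedge a b - sec_wedge a c" for a b c :: "('a, 'b) sec"
    using sec_wedge_linear(1)[of "a - b" b c] sec_wedge_linear(2)[of a "b - c" c] by simp_all
  have "f V (g V (sec_wedge s s')) =
      sec_wedge (f V (g V s)) s' + sec_wedge (g V s) (f V s') +
      (sec_wedge (f V s) (g V s') + sec_wedge s (f V (g V s')))"
    by (simp add: L 6 m hol_sec_wedge sec_linearD(2)[OF l(1)])
  moreover have "g V (f V (sec_wedge s s')) =
      sec_wedge (g V (f V s)) s' + sec_wedge (f V s) (g V s') +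
      (sec_wedge (g V s) (f V s') + sec_wedge s (g V (f V s')))"
    by (simp add: L 6 m hol_sec_wedge sec_linearD(2)[OF l(2)])
  ultimately show ?case
    by (simp add: oper_comm_def bracket_def dl dr)
qed

section \<open>The obstruction cochains\<close>

lemma pr_eq: "pr B d f V s = (if s \<in> hol_sec B V then homog_part B d (f V) s else 0)"
  by (simp add: pr_def homog_part_def)

lemma pr_uminus: "pr B d (- f) = - pr B d f"
proof -
  have "homog_part B d (- g) s = - homog_part B d g s" for g s
    using homog_part_scale[of B d "-1" g s] by (simp add: sec_scale_minus_one fun_Compl_def)
  then show ?thesis by (intro ext) (simp add: pr_eq)
qed

lemma pr_zero: "pr B d 0 = 0"
  by (intro ext) (simp add: pr_eq homog_part_def)

lemma pr_Der_deg:
  assumes "f \<in> Der_deg B d U"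
  shows "pr B n f = (if n = d then f else 0)"
proof (intro ext)
  fix V s x t K
  have "pr B n f V s = (if n = d then f else 0) V s"
  proof (cases "openin (base B) V \<and> V \<subseteq> U \<and> s \<in> hol_sec B V")
    case True
    then show ?thesis
      using homog_part_deg_eq[OF Der_degD(2)[OF assms, of V] Der_degD(3)[OF assms, of V], of s n]
      by (simp add: pr_eq)
  next
    case False
    \<comment> \<open>\<open>pr\<close> does not test whether \<open>V\<close> is an open subset of
      \<open>U\<close>; its value is 0 here because \<open>f V\<close> vanishes identically.\<close>
    have "homog_part B n (f V) s = 0" if "s \<in> hol_sec B V"
    proof -
      have "f V s' = 0" for s' using False that Der_degD(1)[OF assms, of V s'] by blast
      then show ?thesis by (simp add: homog_part_def)
    qed
    then have "pr B n f V s = 0" by (simp add: pr_eq)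
    moreover have "f V s = 0" by (rule Der_degD(1)[OF assms False])
    ultimately show ?thesis by simp
  qed
  then show "pr B n f V s x t K = (if n = d then f else 0) V s x t K" by (rule arg_cong)
qed

lemma pr_sum: "pr B n (\<Sum>k\<in>A. g k) = (\<Sum>k\<in>A. pr B n (g k))"
proof (intro ext)
  fix V s x t K
  have "homog_part B n ((\<Sum>k\<in>A. g k) V) s = (\<Sum>k\<in>A. homog_part B n (g k V) s)"
  proof -
    have "(\<Sum>k\<in>A. g k) V = (\<lambda>s. \<Sum>k\<in>A. g k V s)" by (intro ext) (simp add: sum_apply)
    then show ?thesis by (simp only: homog_part_Sum)
  qed
  then show "pr B n (\<Sum>k\<in>A. g k) V s x t K = (\<Sum>k\<in>A. pr B n (g k)) V s x t K"
    by (simp add: pr_eq sum_apply)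
qed

text \<open>\<open>Der_pos\<close> asserts only that some decomposition exists; since
  \<open>pr\<close> keeps a homogeneous operator or kills it, it recovers the summands. For
  \<open>k\<close> beyond the length \<open>N\<close> the result is 0, again a derivation.\<close>

lemma pr_Der_pos:
  assumes "f \<in> Der_pos B U" "1 \<le> k"
  shows "pr B (2 * k) f \<in> Der_deg B (2 * k) U"
proof -
  obtain N g where g: "\<And>l. l \<in> {1..N} \<Longrightarrow> g l \<in> Der_deg B (2 * l) U" and f: "f = (\<Sum>l=1..N. g l)"
    using assms(1) unfolding Der_pos_def by blast
  have "pr B (2 * k) f = (\<Sum>l=1..N. if l = k then g l else 0)"
    unfolding f pr_sum
  proof (rule sum.cong[OF refl])
    fix l assume "l \<in> {1..N}"
    from pr_Der_deg[OF g[OF this], of "2 * k"]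
    show "pr B (2 * k) (g l) = (if l = k then g l else 0)" by (cases "l = k") simp_all
  qed
  also have "\<dots> = (if k \<in> {1..N} then g k else 0)"
    by (simp only: sum.delta' sum.delta finite_atLeastAtMost)
  finally show ?thesis using g Der_deg_zero[of "2 * k" B U] by auto
qed

lemma bracket_cong:
  assumes "sec_linear B V f'" "sec_linear B V g'" "\<And>s. s \<in> hol_sec B V \<Longrightarrow> f s = f' s"
    "\<And>s. s \<in> hol_sec B V \<Longrightarrow> g s = g' s" "s \<in> hol_sec B V"
  shows "bracket f g s = bracket f' g' s"
  using assms by (simp add: bracket_def sec_linearD(1)[OF assms(1)] sec_linearD(1)[OF assms(2)])

text \<open>Used with \<open>v4 = 0\<close> for R_4(u) and R_6(u_2), and with the actual degree-4
  part for R_6(u). The condition on \<open>v4\<close> is a premise of single lemmas, because its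
  right-hand side R_4 is first computed in the instance \<open>v4 = 0\<close>.\<close>

locale graded_cochain =
  fixes B :: "('m, 'e) vbundle" and I :: "'i set" and U :: "'i \<Rightarrow> 'm set"
    and v2 v4 :: "('i, 'm, 'e) cochain1"
  assumes v2: "i \<in> I \<Longrightarrow> j \<in> I \<Longrightarrow> v2 i j \<in> Der_deg B 2 (U i \<inter> U j)"
    and v4: "i \<in> I \<Longrightarrow> j \<in> I \<Longrightarrow> v4 i j \<in> Der_deg B 4 (U i \<inter> U j)"
    and alt2: "i \<in> I \<Longrightarrow> j \<in> I \<Longrightarrow> v2 j i = - v2 i j"
    and alt4: "i \<in> I \<Longrightarrow> j \<in> I \<Longrightarrow> v4 j i = - v4 i j"
    and cocycle: "coboundary1 B I U v2 = 0"
begin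

lemma lin2: "i \<in> I \<Longrightarrow> j \<in> I \<Longrightarrow> openin (base B) V \<Longrightarrow> V \<subseteq> U i \<inter> U j \<Longrightarrow> sec_linear B V (v2 i j V)"
  using Der_degD(2)[OF v2] by blast

lemma lin4: "i \<in> I \<Longrightarrow> j \<in> I \<Longrightarrow> openin (base B) V \<Longrightarrow> V \<subseteq> U i \<inter> U j \<Longrightarrow> sec_linear B V (v4 i j V)"
  using Der_degD(2)[OF v4] by blast

lemma coboundary1_apply:
  assumes "i \<in> I" "j \<in> I" "k \<in> I" "openin (base B) V" "V \<subseteq> U i \<inter> U j \<inter> U k" "s \<in> hol_sec B V"
  shows "coboundary1 B I U w i j k V s = w j k V s - w i k V s + w i j V s"
  using assms by (simp add: coboundary1_def oper_restrict_def)

lemma v2_add: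
  assumes "i \<in> I" "j \<in> I" "k \<in> I" "openin (base B) V" "V \<subseteq> U i \<inter> U j \<inter> U k" "s \<in> hol_sec B V"
  shows "v2 i k V s = v2 i j V s + v2 j k V s"
  using coboundary1_apply[OF assms, of v2] unfolding cocycle
  by (simp add: algebra_simps)

text \<open>The three factors belong to ij, jk and ki; alternation and the cocycle condition express
  the degree-2 part of the last one. The premise on \<open>v4 i k\<close> is du_4 = -R_4, with R_4
  half the bracket, solved for \<open>v4 i k\<close>.\<close>

lemma exp_triple:
  assumes "i \<in> I" "j \<in> I" "k \<in> I" "openin (base B) V" "V \<subseteq> U i \<inter> U j \<inter> U k"
    and w: "w = v2 + v4"
  shows "s \<in> hol_sec B V \<Longrightarrow> pr B 4 (dexp B I U w i j k) V s =
      v4 i j V s + v4 j k V s + v4 k i V s + sec_scale (1 / 2) (bracket (v2 i j V) (v2 j k V) s)"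
    and "s \<in> hol_sec B V \<Longrightarrow>
      (\<And>s. s \<in> hol_sec B V \<Longrightarrow> v4 i k V s =
        v4 i j V s + v4 j k V s + sec_scale (1 / 2) (bracket (v2 i j V) (v2 j k V) s)) \<Longrightarrow>
      pr B 6 (dexp B I U w i j k) V s =
        sec_scale (1 / 2) (bracket (v2 i j V) (v4 j k V) s + bracket (v4 i j V) (v2 j k V) s) +
        sec_scale (1 / 12) (bracket (v2 i j V) (bracket (v2 i j V) (v2 j k V)) s -
          bracket (v2 j k V) (bracket (v2 i j V) (v2 j k V)) s)"
    and "s \<in> hol_sec B V \<Longrightarrow> v4 = 0 \<Longrightarrow>
      pr B 6 (dexp B I U w i j k) V s =
        sec_scale (1 / 3) (bracket (v2 i j V) (bracket (v2 i j V) (v2 j k V)) s) +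
        sec_scale (1 / 6) (bracket (v2 j k V) (bracket (v2 i j V) (v2 j k V)) s)"
proof -
  have sub: "V \<subseteq> U i \<inter> U j" "V \<subseteq> U j \<inter> U k" "V \<subseteq> U k \<inter> U i" using assms(5) by blast+
  note ij = assms(1,2) note jk = assms(2,3) note ki = assms(3,1)
  note d2 = Der_degD(3)[OF v2 assms(4)] and d4 = Der_degD(3)[OF v4 assms(4)]
  have w': "w i j V s = v2 i j V s + v4 i j V s" for i j s by (simp add: w)
  have c2: "v2 k i V s = - v2 i j V s - v2 j k V s" if "s \<in> hol_sec B V" for s
    using v2_add[OF assms(1-5) that] alt2[OF assms(1,3)] by simp
  have c4: "v4 k i V s = - v4 i k V s" for s
    using alt4[OF assms(1,3)] by simp
  note T = exp_triple_low_degree[where Fa = "w i j" and Fb = "w j k" and Fc = "w k i",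
      OF lin2[OF ij assms(4) sub(1)] d2[OF ij sub(1)] lin4[OF ij assms(4) sub(1)] d4[OF ij sub(1)]
      lin2[OF jk assms(4) sub(2)] d2[OF jk sub(2)] lin4[OF jk assms(4) sub(2)] d4[OF jk sub(2)]
      lin2[OF ki assms(4) sub(3)] d2[OF ki sub(3)] lin4[OF ki assms(4) sub(3)] d4[OF ki sub(3)]
      w' w' w' c2]
  have pr: "pr B n (dexp B I U w i j k) V s =
      homog_part B n (\<lambda>s. oper_exp (w i j) V (oper_exp (w j k) V (oper_exp (w k i) V s))) s"
    if "s \<in> hol_sec B V" for n s
    using homog_part_cong[of B V "dexp B I U w i j k V"
        "\<lambda>s. oper_exp (w i j) V (oper_exp (w j k) V (oper_exp (w k i) V s))" s n] assms that
    by (simp add: pr_eq dexp_def oper_restrict_def oper_comp_def)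
  show "pr B 4 (dexp B I U w i j k) V s =
      v4 i j V s + v4 j k V s + v4 k i V s + sec_scale (1 / 2) (bracket (v2 i j V) (v2 j k V) s)"
    if "s \<in> hol_sec B V"
    unfolding pr[OF that] by (rule T(1)[OF _ that])
  show "pr B 6 (dexp B I U w i j k) V s =
        sec_scale (1 / 2) (bracket (v2 i j V) (v4 j k V) s + bracket (v4 i j V) (v2 j k V) s) +
        sec_scale (1 / 12) (bracket (v2 i j V) (bracket (v2 i j V) (v2 j k V)) s -
          bracket (v2 j k V) (bracket (v2 i j V) (v2 j k V)) s)"
    if "s \<in> hol_sec B V" and v4ik: "\<And>s. s \<in> hol_sec B V \<Longrightarrow> v4 i k V s =
        v4 i j V s + v4 j k V s + sec_scale (1 / 2) (bracket (v2 i j V) (v2 j k V) s)"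
    unfolding pr[OF that(1)] by (rule T(2)[OF _ that(1)]) (simp_all add: c4 v4ik)
  show "pr B 6 (dexp B I U w i j k) V s =
        sec_scale (1 / 3) (bracket (v2 i j V) (bracket (v2 i j V) (v2 j k V)) s) +
        sec_scale (1 / 6) (bracket (v2 j k V) (bracket (v2 i j V) (v2 j k V)) s)"
    if "s \<in> hol_sec B V" "v4 = 0"
    unfolding pr[OF that(1)] by (rule T(3)[OF _ that(1)]) (simp_all add: that(2))
qed

lemma dexp_outside:
  assumes "i \<in> I" "j \<in> I" "k \<in> I" "\<not> (openin (base B) V \<and> V \<subseteq> U i \<inter> U j \<inter> U k \<and> s \<in> hol_sec B V)"
  shows "pr B n (dexp B I U w i j k) V s = 0"
proof (cases "s \<in> hol_sec B V")
  case True
  then have "dexp B I U w i j k V s' = 0" for s'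
    using assms by (auto simp: dexp_def oper_restrict_def)
  then show ?thesis by (simp add: pr_eq homog_part_def)
qed (simp add: pr_eq)

text \<open>Both operators are 0 off the holomorphic sections over open subsets of the triple
  intersection, so agreement on these is equality.\<close>

lemma pr_dexp_Der_deg:
  assumes "i \<in> I" "j \<in> I" "k \<in> I" and T: "T \<in> Der_deg B d (U i \<inter> U j \<inter> U k)"
    and eq: "\<And>V s. openin (base B) V \<Longrightarrow> V \<subseteq> U i \<inter> U j \<inter> U k \<Longrightarrow> s \<in> hol_sec B V \<Longrightarrow>
      pr B n (dexp B I U w i j k) V s = T V s"
  shows "pr B n (dexp B I U w i j k) \<in> Der_deg B d (U i \<inter> U j \<inter> U k)"
proof -
  have "pr B n (dexp B I U w i j k) V s = T V s" for V s
    using eq[of V s] dexp_outside[OF assms(1-3), of V s n w] Der_degD(1)[OF T, of V s] by argo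
  then have "pr B n (dexp B I U w i j k) = T" by (intro ext) simp
  then show ?thesis using T by simp
qed

lemma restrict_Der_deg:
  assumes "i \<in> I" "j \<in> I" "k \<in> I"
  shows "oper_restrict B (U i \<inter> U j \<inter> U k) (v2 i j) \<in> Der_deg B 2 (U i \<inter> U j \<inter> U k)"
    and "oper_restrict B (U i \<inter> U j \<inter> U k) (v2 j k) \<in> Der_deg B 2 (U i \<inter> U j \<inter> U k)"
    and "oper_restrict B (U i \<inter> U j \<inter> U k) (v4 i j) \<in> Der_deg B 4 (U i \<inter> U j \<inter> U k)"
    and "oper_restrict B (U i \<inter> U j \<inter> U k) (v4 j k) \<in> Der_deg B 4 (U i \<inter> U j \<inter> U k)"
  by (rule Der_deg_restrict[OF _ v2] Der_deg_restrict[OF _ v4]; use assms in auto)+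

lemma pr_dexp_derivation:
  assumes "i \<in> I" "j \<in> I" "k \<in> I" and w: "w = v2 + v4"
  shows "v4 = 0 \<Longrightarrow> pr B 4 (dexp B I U w i j k) \<in> Der_deg B 4 (U i \<inter> U j \<inter> U k)"
    and "v4 = 0 \<Longrightarrow> pr B 6 (dexp B I U w i j k) \<in> Der_deg B 6 (U i \<inter> U j \<inter> U k)"
    and "(\<And>V s. openin (base B) V \<Longrightarrow> V \<subseteq> U i \<inter> U j \<inter> U k \<Longrightarrow> s \<in> hol_sec B V \<Longrightarrow> v4 i k V s =
        v4 i j V s + v4 j k V s + sec_scale (1 / 2) (bracket (v2 i j V) (v2 j k V) s)) \<Longrightarrow>
      pr B 6 (dexp B I U w i j k) \<in> Der_deg B 6 (U i \<inter> U j \<inter> U k)"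
proof -
  let ?W = "U i \<inter> U j \<inter> U k"
  let ?r = "oper_restrict B ?W"
  let ?a2 = "?r (v2 i j)" and ?b2 = "?r (v2 j k)" and ?a4 = "?r (v4 i j)" and ?b4 = "?r (v4 j k)"
  note D = restrict_Der_deg[OF assms(1-3)]
  have ab: "oper_comm ?a2 ?b2 \<in> Der_deg B 4 ?W"
    using Der_deg_comm[OF _ _ D(1,2)] by simp
  have aab: "oper_comm ?a2 (oper_comm ?a2 ?b2) \<in> Der_deg B 6 ?W"
    and bab: "oper_comm ?b2 (oper_comm ?a2 ?b2) \<in> Der_deg B 6 ?W"
    using Der_deg_comm[OF _ _ D(1) ab] Der_deg_comm[OF _ _ D(2) ab] by simp_all
  have a2b4: "oper_comm ?a2 ?b4 \<in> Der_deg B 6 ?W" and a4b2: "oper_comm ?a4 ?b2 \<in> Der_deg B 6 ?W"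
    using Der_deg_comm[OF _ _ D(1,4)] Der_deg_comm[OF _ _ D(3,2)] by simp_all
  \<comment> \<open>To be derivations over the triple intersection the brackets are formed from
    restricted operators, whereas \<open>exp_triple\<close> speaks of the unrestricted ones; over
    \<open>V \<subseteq> ?W\<close> the two agree.\<close>
  have pointwise:
    "oper_comm ?a2 ?b2 V s = bracket (v2 i j V) (v2 j k V) s"
    "oper_comm ?a2 (oper_comm ?a2 ?b2) V s = bracket (v2 i j V) (bracket (v2 i j V) (v2 j k V)) s"
    "oper_comm ?b2 (oper_comm ?a2 ?b2) V s = bracket (v2 j k V) (bracket (v2 i j V) (v2 j k V)) s"
    "oper_comm ?a2 ?b4 V s = bracket (v2 i j V) (v4 j k V) s"
    "oper_comm ?a4 ?b2 V s = bracket (v4 i j V) (v2 j k V) s"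
    if V: "openin (base B) V" "V \<subseteq> ?W" and s: "s \<in> hol_sec B V" for V s
  proof -
    have sub: "V \<subseteq> U i \<inter> U j" "V \<subseteq> U j \<inter> U k" using V(2) by blast+
    note l2 = lin2[OF assms(1,2) V(1) sub(1)] lin2[OF assms(2,3) V(1) sub(2)]
    note l4 = lin4[OF assms(1,2) V(1) sub(1)] lin4[OF assms(2,3) V(1) sub(2)]
    have r: "?r f V t = f V t" if "t \<in> hol_sec B V" for f t
      using that V by (simp add: oper_restrict_def)
    have e: "bracket (?r (v2 i j) V) (?r (v2 j k) V) t = bracket (v2 i j V) (v2 j k V) t"
      if "t \<in> hol_sec B V" for t
      by (rule bracket_cong[OF l2 _ _ that]) (simp_all only: r)
    note lb = sec_linear_bracket[OF l2]
    show "oper_comm ?a2 ?b2 V s = bracket (v2 i j V) (v2 j k V) s"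
      unfolding oper_comm_def by (rule e[OF s])
    show "oper_comm ?a2 (oper_comm ?a2 ?b2) V s = bracket (v2 i j V) (bracket (v2 i j V) (v2 j k V)) s"
      unfolding oper_comm_def by (rule bracket_cong[OF l2(1) lb _ _ s]) (simp_all only: r e)
    show "oper_comm ?b2 (oper_comm ?a2 ?b2) V s = bracket (v2 j k V) (bracket (v2 i j V) (v2 j k V)) s"
      unfolding oper_comm_def by (rule bracket_cong[OF l2(2) lb _ _ s]) (simp_all only: r e)
    show "oper_comm ?a2 ?b4 V s = bracket (v2 i j V) (v4 j k V) s"
      unfolding oper_comm_def by (rule bracket_cong[OF l2(1) l4(2) _ _ s]) (simp_all only: r)
    show "oper_comm ?a4 ?b2 V s = bracket (v4 i j V) (v2 j k V) s"
      unfolding oper_comm_def by (rule bracket_cong[OF l4(1) l2(2) _ _ s]) (simp_all only: r)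
  qed
  show "pr B 4 (dexp B I U w i j k) \<in> Der_deg B 4 ?W" if "v4 = 0"
  proof (rule pr_dexp_Der_deg[OF assms(1-3)])
    show "oper_scale (1 / 2) (oper_comm ?a2 ?b2) \<in> Der_deg B 4 ?W"
      by (rule Der_deg_scale[OF _ ab]) simp
    show "pr B 4 (dexp B I U w i j k) V s = oper_scale (1 / 2) (oper_comm ?a2 ?b2) V s"
      if V: "openin (base B) V" "V \<subseteq> ?W" and s: "s \<in> hol_sec B V" for V s
      unfolding exp_triple(1)[OF assms(1-3) V w s] oper_scale_def pointwise[OF V s]
      by (simp add: \<open>v4 = 0\<close>)
  qed
  show "pr B 6 (dexp B I U w i j k) \<in> Der_deg B 6 ?W" if "v4 = 0"
  proof (rule pr_dexp_Der_deg[OF assms(1-3)])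
    let ?T = "oper_scale (1 / 3) (oper_comm ?a2 (oper_comm ?a2 ?b2)) +
        oper_scale (1 / 6) (oper_comm ?b2 (oper_comm ?a2 ?b2))"
    show "?T \<in> Der_deg B 6 ?W"
      by (intro Der_deg_add Der_deg_scale aab bab) simp_all
    show "pr B 6 (dexp B I U w i j k) V s = ?T V s"
      if V: "openin (base B) V" "V \<subseteq> ?W" and s: "s \<in> hol_sec B V" for V s
      unfolding exp_triple(3)[OF assms(1-3) V w s \<open>v4 = 0\<close>] oper_scale_def plus_fun_apply pointwise[OF V s] ..
  qed
  show "pr B 6 (dexp B I U w i j k) \<in> Der_deg B 6 ?W"
    if v4ik: "\<And>V s. openin (base B) V \<Longrightarrow> V \<subseteq> ?W \<Longrightarrow> s \<in> hol_sec B V \<Longrightarrow> v4 i k V s =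
        v4 i j V s + v4 j k V s + sec_scale (1 / 2) (bracket (v2 i j V) (v2 j k V) s)"
  proof (rule pr_dexp_Der_deg[OF assms(1-3)])
    let ?T = "oper_scale (1 / 2) (oper_comm ?a2 ?b4 + oper_comm ?a4 ?b2) +
        oper_scale (1 / 12) (oper_comm ?a2 (oper_comm ?a2 ?b2) - oper_comm ?b2 (oper_comm ?a2 ?b2))"
    show "?T \<in> Der_deg B 6 ?W"
      by (intro Der_deg_add Der_deg_diff Der_deg_scale aab bab a2b4 a4b2) simp_all
    show "pr B 6 (dexp B I U w i j k) V s = ?T V s"
      if V: "openin (base B) V" "V \<subseteq> ?W" and s: "s \<in> hol_sec B V" for V s
      by (simp only: exp_triple(2)[OF assms(1-3) V w s v4ik[OF V]] oper_scale_def plus_fun_apply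
          minus_apply pointwise[OF V s])
  qed
qed

text \<open>With a, b, c for the values at ij, jk, kl, the claim is half of [b, c] - [a + b, c] +
  [a, b + c] - [a, b] = 0.\<close>

lemma pr4_dexp_cocycle:
  assumes I: "i \<in> I" "j \<in> I" "k \<in> I" "l \<in> I" and V: "openin (base B) V" "V \<subseteq> U i \<inter> U j \<inter> U k \<inter> U l"
    and s: "s \<in> hol_sec B V" and w: "w = v2 + v4" and "v4 = 0"
  defines "P \<equiv> \<lambda>i j k. pr B 4 (dexp B I U w i j k) V s"
  shows "P j k l - P i k l + P i j l - P i j k = 0"
proof -
  have sub: "V \<subseteq> U i \<inter> U j \<inter> U k" "V \<subseteq> U j \<inter> U k \<inter> U l" "V \<subseteq> U i \<inter> U k \<inter> U l" "V \<subseteq> U i \<inter> U j \<inter> U l"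
    and sub2: "V \<subseteq> U i \<inter> U j" "V \<subseteq> U j \<inter> U k" "V \<subseteq> U k \<inter> U l"
    using V(2) by blast+
  note P = exp_triple(1)[OF I(1,2,3) V(1) sub(1) w s] exp_triple(1)[OF I(2,3,4) V(1) sub(2) w s]
    exp_triple(1)[OF I(1,3,4) V(1) sub(3) w s] exp_triple(1)[OF I(1,2,4) V(1) sub(4) w s]
  note lin = sec_linear_rules[OF lin2[OF I(1,2) V(1) sub2(1)]]
    sec_linear_rules[OF lin2[OF I(2,3) V(1) sub2(2)]] sec_linear_rules[OF lin2[OF I(3,4) V(1) sub2(3)]]
  note add = v2_add[OF I(1,2,3) V(1) sub(1)] v2_add[OF I(2,3,4) V(1) sub(2)]
  show ?thesis
    unfolding P_def P bracket_def
    by (intro ext) (simp add: \<open>v4 = 0\<close> add lin s hol_sec_closed sec_scale_apply field_simps)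
qed

text \<open>Behind the identity stands associativity: the Baker-Campbell-Hausdorff product of the
  values at ij and jk is the value at ik plus \<open>P i j k\<close> up to degree 6. Bracketing the
  triple product for ij, jk, kl in the two possible ways gives \<open>P i j k + P i k l\<close> and
  \<open>P j k l + P i j l\<close> as correction terms.\<close>

lemma pr6_dexp_cocycle:
  assumes I: "i \<in> I" "j \<in> I" "k \<in> I" "l \<in> I" and V: "openin (base B) V" "V \<subseteq> U i \<inter> U j \<inter> U k \<inter> U l"
    and s: "s \<in> hol_sec B V" and w: "w = v2 + v4"
    and v4_add: "\<And>i j k V s. i \<in> I \<Longrightarrow> j \<in> I \<Longrightarrow> k \<in> I \<Longrightarrow> openin (base B) V \<Longrightarrow>
      V \<subseteq> U i \<inter> U j \<inter> U k \<Longrightarrow> s \<in> hol_sec B V \<Longrightarrow> v4 i k V s =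
        v4 i j V s + v4 j k V s + sec_scale (1 / 2) (bracket (v2 i j V) (v2 j k V) s)"
  defines "P \<equiv> \<lambda>i j k. pr B 6 (dexp B I U w i j k) V s"
  shows "P j k l - P i k l + P i j l - P i j k = 0"
proof -
  have sub: "V \<subseteq> U i \<inter> U j \<inter> U k" "V \<subseteq> U j \<inter> U k \<inter> U l" "V \<subseteq> U i \<inter> U k \<inter> U l" "V \<subseteq> U i \<inter> U j \<inter> U l"
    and sub2: "V \<subseteq> U i \<inter> U j" "V \<subseteq> U j \<inter> U k" "V \<subseteq> U k \<inter> U l"
    using V(2) by blast+
  note a4 = v4_add[OF I(1,2,3) V(1) sub(1)] v4_add[OF I(2,3,4) V(1) sub(2)]
    v4_add[OF I(1,3,4) V(1) sub(3)] v4_add[OF I(1,2,4) V(1) sub(4)]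
  note P = exp_triple(2)[OF I(1,2,3) V(1) sub(1) w s a4(1)]
    exp_triple(2)[OF I(2,3,4) V(1) sub(2) w s a4(2)]
    exp_triple(2)[OF I(1,3,4) V(1) sub(3) w s a4(3)]
    exp_triple(2)[OF I(1,2,4) V(1) sub(4) w s a4(4)]
  note lin = sec_linear_rules[OF lin2[OF I(1,2) V(1) sub2(1)]]
    sec_linear_rules[OF lin2[OF I(2,3) V(1) sub2(2)]] sec_linear_rules[OF lin2[OF I(3,4) V(1) sub2(3)]]
    sec_linear_rules[OF lin4[OF I(1,2) V(1) sub2(1)]]
    sec_linear_rules[OF lin4[OF I(2,3) V(1) sub2(2)]] sec_linear_rules[OF lin4[OF I(3,4) V(1) sub2(3)]]
  \<comment> \<open>The formulas in \<open>P\<close> have already eliminated the values at il, so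
    only those at ik and jl remain to be expressed through ij, jk and kl.\<close>
  note add = v2_add[OF I(1,2,3) V(1) sub(1)] v2_add[OF I(2,3,4) V(1) sub(2)]
    a4(1,2)[unfolded bracket_def]
  show ?thesis
    unfolding P_def
    by (simp only: P, unfold bracket_def, intro ext) (simp add: add lin s hol_sec_closed sec_scale_apply field_simps)
qed

end

section \<open>From operators to cochains, and the two assertions\<close>

lemma pr2_dexp_C2I:
  assumes "\<And>i j k. i \<in> I \<Longrightarrow> j \<in> I \<Longrightarrow> k \<in> I \<Longrightarrow> pr B n (dexp B I U w i j k) \<in> F (U i \<inter> U j \<inter> U k)"
  shows "pr2 B n (dexp B I U w) \<in> C2 I U F"
proof -
  have "pr2 B n (dexp B I U w) i j k = 0" if "\<not> (i \<in> I \<and> j \<in> I \<and> k \<in> I)" for i j k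
    using that unfolding pr2_def dexp_def by (simp only: if_False pr_zero)
  then show ?thesis unfolding C2_def using assms by (simp add: pr2_def)
qed

lemma coboundary2_zeroI:
  assumes "\<And>i j k l V s. i \<in> I \<Longrightarrow> j \<in> I \<Longrightarrow> k \<in> I \<Longrightarrow> l \<in> I \<Longrightarrow> openin (base B) V \<Longrightarrow>
    V \<subseteq> U i \<inter> U j \<inter> U k \<inter> U l \<Longrightarrow> s \<in> hol_sec B V \<Longrightarrow>
    w j k l V s - w i k l V s + w i j l V s - w i j k V s = 0"
  shows "coboundary2 B I U w = 0"
proof (intro ext)
  fix i j k l V s x t K
  have "coboundary2 B I U w i j k l V s = 0"
    using assms[of i j k l V s] by (simp add: coboundary2_def oper_restrict_def)
  then show "coboundary2 B I U w i j k l V s x t K = 0 i j k l V s x t K" by simp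
qed

lemma C2_mono: "(\<And>V. F V \<subseteq> G V) \<Longrightarrow> C2 I U F \<subseteq> C2 I U G"
  unfolding C2_def by blast

theorem proposition2p1:
  fixes B :: "('m, 'e) vbundle" and I :: "'i set" and U :: "'i \<Rightarrow> 'm set"
    and u :: "('i, 'm, 'e) cochain1"
  assumes "holomorphic_vector_bundle B"
    and "open_cover (base B) I U"
    and "u \<in> C1 I U (Der_pos B)"
  shows "(coboundary1 B I U (pr1 B 2 u) = 0 \<longrightarrow>
            R B I U 4 u \<in> Z2 B I U (End_deg B 4)) \<and>
         (coboundary1 B I U (pr1 B 2 u) = 0 \<and>
          coboundary1 B I U (pr1 B 4 u) = - R B I U 4 u \<longrightarrow>
            R B I U 6 u \<in> Z2 B I U (End_deg B 6) \<and>
            (R B I U 6 u \<in> Z2 B I U (Der_deg B 6) \<longleftrightarrow>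
             R B I U 6 (pr1 B 2 u) \<in> C2 I U (Der_deg B 6)))"
proof -
  define u2 where "u2 = pr1 B 2 u"
  define u4 where "u4 = pr1 B 4 u"
  have Der: "pr1 B (2 * m) u i j \<in> Der_deg B (2 * m) (U i \<inter> U j)"
    and alt: "pr1 B d u j i = - pr1 B d u i j"
    if "i \<in> I" "j \<in> I" "1 \<le> m" for i j m d
  proof -
    have "u i j \<in> Der_pos B (U i \<inter> U j)" "u j i = - u i j"
      using assms(3)[unfolded C1_def mem_Collect_eq, THEN conjunct1, THEN bspec, THEN bspec,
          OF that(1,2)] by (rule conjunct1, rule conjunct2)
    then show "pr1 B (2 * m) u i j \<in> Der_deg B (2 * m) (U i \<inter> U j)"
      and "pr1 B d u j i = - pr1 B d u i j"
      using that(3) by (simp_all add: pr1_def pr_Der_pos pr_uminus)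
  qed
  have Der2: "u2 i j \<in> Der_deg B 2 (U i \<inter> U j)" and Der4: "u4 i j \<in> Der_deg B 4 (U i \<inter> U j)"
    and alt2: "u2 j i = - u2 i j" and alt4: "u4 j i = - u4 i j" if "i \<in> I" "j \<in> I" for i j
    using Der[OF that, of 1] Der[OF that, of 2] alt[OF that, of 1] by (simp_all add: u2_def u4_def)
  have out: "u2 i j = 0" if "\<not> (i \<in> I \<and> j \<in> I)" for i j
  proof -
    have "u i j = 0"
      by (rule assms(3)[unfolded C1_def mem_Collect_eq, THEN conjunct2, THEN spec, THEN spec,
            THEN mp, OF that])
    then show ?thesis by (simp only: u2_def pr1_def pr_zero)
  qed
  \<comment> \<open>R_6(u_2) projects its argument once more; as \<open>u2\<close> is homogeneous,
    its degree-4 part is 0.\<close>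
  have pr_u2: "pr1 B n u2 = (if n = 2 then u2 else 0)" for n
  proof (intro ext)
    fix i j V s x t K
    have "pr1 B n u2 i j = (if n = 2 then u2 else 0) i j"
    proof (cases "i \<in> I \<and> j \<in> I")
      case True
      then show ?thesis using pr_Der_deg[OF Der2, of i j n] by (cases "n = 2") (simp_all add: pr1_def)
    next
      case False
      then show ?thesis using out[OF False] by (cases "n = 2") (simp_all add: pr1_def pr_zero)
    qed
    then show "pr1 B n u2 i j V s x t K = (if n = 2 then u2 else 0) i j V s x t K" by simp
  qed
  \<comment> \<open>The limit \<open>d div 2 - 1\<close> is 1 for \<open>d = 4\<close> and 2 for
    \<open>d = 6\<close>, so the exponents are \<open>u2\<close> and \<open>u2 + u4\<close>.\<close>
  have "{1..1::nat} = {1}" "{1..2::nat} = {1, 2}" by auto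
  then have R4: "R B I U 4 u = pr2 B 4 (dexp B I U u2)"
    and R6: "R B I U 6 u = pr2 B 6 (dexp B I U (u2 + u4))"
    and R6': "R B I U 6 u2 = pr2 B 6 (dexp B I U u2)"
    by (simp_all add: R_def u2_def[symmetric] u4_def[symmetric] pr_u2)
  have sub: "C2 I U (Der_deg B d) \<subseteq> C2 I U (End_deg B d)" for d
    by (rule C2_mono) (simp add: Der_deg_def)
  \<comment> \<open>Consequences of du_2 = 0 alone. R_4(u) and R_6(u_2) involve only
    \<open>u2\<close> and are computed with degree-4 part 0; the right-hand side of the equivalence
    is settled here.\<close>
  have one: "R B I U 4 u \<in> Z2 B I U (End_deg B 4)" and six': "R B I U 6 u2 \<in> C2 I U (Der_deg B 6)"
    and gc: "graded_cochain B I U u2 u4"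
    and R4_apply: "\<And>i j k V s. i \<in> I \<Longrightarrow> j \<in> I \<Longrightarrow> k \<in> I \<Longrightarrow> openin (base B) V \<Longrightarrow>
      V \<subseteq> U i \<inter> U j \<inter> U k \<Longrightarrow> s \<in> hol_sec B V \<Longrightarrow>
      R B I U 4 u i j k V s = sec_scale (1 / 2) (bracket (u2 i j V) (u2 j k V) s)"
    if du2: "coboundary1 B I U u2 = 0"
  proof -
    interpret X: graded_cochain B I U u2 0
      by unfold_locales (erule (1) Der2 alt2 | simp add: Der_deg_zero du2)+
    show "graded_cochain B I U u2 u4"
      by unfold_locales (erule (1) Der2 alt2 Der4 alt4 | rule du2)+
    have "R B I U 4 u \<in> C2 I U (Der_deg B 4)"
      unfolding R4 by (rule pr2_dexp_C2I, rule X.pr_dexp_derivation(1)) simp_all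
    moreover have "coboundary2 B I U (R B I U 4 u) = 0"
      unfolding R4 pr2_def by (rule coboundary2_zeroI, rule X.pr4_dexp_cocycle) simp_all
    ultimately show "R B I U 4 u \<in> Z2 B I U (End_deg B 4)"
      using sub unfolding Z2_def by blast
    show "R B I U 6 u2 \<in> C2 I U (Der_deg B 6)"
      unfolding R6' by (rule pr2_dexp_C2I, rule X.pr_dexp_derivation(2)) simp_all
    show "R B I U 4 u i j k V s = sec_scale (1 / 2) (bracket (u2 i j V) (u2 j k V) s)"
      if "i \<in> I" "j \<in> I" "k \<in> I" "openin (base B) V" "V \<subseteq> U i \<inter> U j \<inter> U k" "s \<in> hol_sec B V"
      for i j k V s
      using X.exp_triple(1)[OF that(1-5) _ that(6), of u2] by (simp add: R4 pr2_def)
  qed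
  \<comment> \<open>The stronger version with derivations: it implies the statement for
    endomorphisms and makes the left-hand side of the equivalence true as well.\<close>
  have two: "R B I U 6 u \<in> Z2 B I U (Der_deg B 6)"
    if du2: "coboundary1 B I U u2 = 0" and du4: "coboundary1 B I U u4 = - R B I U 4 u"
  proof -
    interpret Y: graded_cochain B I U u2 u4 by (rule gc[OF du2])
    \<comment> \<open>The condition du_4 = -R_4(u) takes the form required by the locale once R_4(u)
      is known to be half a bracket.\<close>
    have u4_add: "u4 i k V s = u4 i j V s + u4 j k V s +
        sec_scale (1 / 2) (bracket (u2 i j V) (u2 j k V) s)"
      if "i \<in> I" "j \<in> I" "k \<in> I" "openin (base B) V" "V \<subseteq> U i \<inter> U j \<inter> U k" "s \<in> hol_sec B V"
      for i j k V s
    proof -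
      have "u4 j k V s - u4 i k V s + u4 i j V s = - R B I U 4 u i j k V s"
        using Y.coboundary1_apply[OF that, of u4] unfolding du4 by simp
      then show ?thesis unfolding R4_apply[OF du2 that] by (simp add: algebra_simps)
    qed
    have "R B I U 6 u \<in> C2 I U (Der_deg B 6)"
      unfolding R6
      by (rule pr2_dexp_C2I, rule Y.pr_dexp_derivation(3)) (simp_all only: u4_add)
    moreover have "coboundary2 B I U (R B I U 6 u) = 0"
      unfolding R6 pr2_def by (rule coboundary2_zeroI, rule Y.pr6_dexp_cocycle) (simp_all only: u4_add)
    ultimately show ?thesis unfolding Z2_def by blast
  qed
  have "R B I U 6 u \<in> Z2 B I U (End_deg B 6)" if "R B I U 6 u \<in> Z2 B I U (Der_deg B 6)"
    using that sub unfolding Z2_def by blast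
  then show ?thesis
    using one two six' unfolding u2_def u4_def by blast
qed

end
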